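(* Let $a$ be a positive integer and $b$ an integer with $b>-a$, $a$ even, and $\gcd(a,b)=1$. Then the set $\{x(ax+b):\ x\in\mathbb{N}\}$ is an asymptotic base of order four. Moreover, if $n$ is an odd integer greater than $$4a(7a(a-1)+1)+2(7a-2)b+2(2a(2a-1)+b)\sqrt{6(2a(a-1)+b)},$$ or $n$ is an even integer with $n/4$ greater than $$28a^3-14a^2+a+(7a-1)b+\left(2a(4a-1)+b\right)\sqrt{3(2a(2a-1)+b)},$$ then $n$ can be written as $$w(aw+b)+x(ax+b)+y(ay+b)+z(az+b)$$ with $w,x,y,z\in\mathbb{N}$.
   Context: $\mathbb{N}=\{0,1,2,\ldots\}$. A subset $A\subseteq\mathbb{N}$ is called an asymptotic base of order $k$ if $\mathbb{N}\setminus kA$ is finite, where $kA=\{a_1+\cdots+a_k:\ a_1,\ldots,a_k\in A\}$. *)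

theory Defs
  imports Complex_Main
begin

definition kfold_sumset :: "nat \<Rightarrow> nat set \<Rightarrow> nat set" where
  "kfold_sumset k A = {sum_list xs | xs. length xs = k \<and> set xs \<subseteq> A}"

definition asymptotic_base :: "nat \<Rightarrow> nat set \<Rightarrow> bool" where
  "asymptotic_base k A \<longleftrightarrow> finite (UNIV - kfold_sumset k A)"

text \<open>
  The polynomial \<open>x(ax+b)\<close> has integer coefficients, but for \<open>b > -a\<close> it takes
  only nonnegative values on the naturals, so its value set can be taken as a set of
  naturals without truncation; see \<open>int_image_quad_values\<close> below.
\<close>

definition quad_values :: "int \<Rightarrow> int \<Rightarrow> nat set" where
  "quad_values a b = {m. \<exists>x::nat. int m = int x * (a * int x + b)}"

lemma quad_value_nonneg:
  fixes a b :: int and x :: nat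
  assumes "0 < a" "- a < b"
  shows "0 \<le> int x * (a * int x + b)"
proof (cases "x = 0")
  case False
  then have "a * 1 \<le> a * int x"
    using assms by (intro mult_left_mono) auto
  then have "0 \<le> a * int x + b"
    using assms by linarith
  then show ?thesis by simp
qed simp

lemma int_image_quad_values:
  fixes a b :: int
  assumes "0 < a" "- a < b"
  shows "int ` quad_values a b = {int x * (a * int x + b) | x :: nat. True}"
proof
  show "{int x * (a * int x + b) | x :: nat. True} \<subseteq> int ` quad_values a b"
  proof clarify
    fix x :: nat
    have "int (nat (int x * (a * int x + b))) = int x * (a * int x + b)"
      using quad_value_nonneg[OF assms] by simp
    then show "int x * (a * int x + b) \<in> int ` quad_values a b"
      unfolding quad_values_def by (metis (mono_tags, lifting) image_eqI mem_Collect_eq)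
  qed
qed (auto simp: quad_values_def)

end

theory Submission
  imports Defs "HOL-Analysis.Infinite_Sum"
begin

text \<open>
  Since \<open>n = a s + b t\<close> with \<open>s\<close> the sum of the squares and \<open>t\<close> the sum of \<open>w, x, y, z\<close>, it suffices by
  Cauchy's lemma to choose \<open>t\<close> in a suitable residue class such that \<open>t^2 < 4 s\<close> and \<open>3 s < t^2 + 2 t + 4\<close>.
  These inequalities confine \<open>t\<close> to an interval, and the lower bounds on \<open>n\<close> say that this interval is
  longer than \<open>2 a\<close> (odd \<open>n\<close>) or \<open>4 a\<close> (even \<open>n\<close>).

  Cauchy's lemma needs the three-square theorem for \<open>n \<equiv> 1, 2 (mod 4)\<close> and \<open>n \<equiv> 3 (mod 8)\<close>, which is
  obtained without Dirichlet's theorem from the identity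
  \<open>(\<Sum>n. (-1)^n q^(n^2))^3 = 1 - 6 \<Sum> (-1)^(r+s) q^(r s) - 4 \<Sum> (-1)^(r+s+t) q^(r s + s t + t r)\<close>
  with sums over positive \<open>r, s, t\<close>: for such \<open>n\<close> parity (and, mod 8, an injection between triples)
  shows that the coefficients of \<open>q^n\<close> on the right do not cancel.
\<close>

subsection \<open>Sums over the integers\<close>

text \<open>The series \<open>pn\<close> and, in the two-square part, \<open>hn\<close> satisfy the
  two-term recurrence of a theta series, so each is known up to one scalar. The scalar
  \<open>pn 0\<close> expands directly into the pair and triple sums of the identity. It is
  evaluated a second time by summing (-1)^m pn(2m): this is theta3 times \<open>pn 0\<close>, and
  also, up to a factor, a product of two Lambert series, at q and at q^2. Jacobi's two-square
  theorem turns these into theta4(q)^2 and theta4(q^2)^2 = theta3 theta4; cancelling theta3 leaves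
  the cube. A real q in (0,1), rather than a formal variable, gives meaning to sums infinite in both
  directions and to the limit q -> 0 that fixes the constant in the two-square theorem. Coefficients
  are compared only at the end. In the application, a even makes b odd and so invertible modulo 2a.
  Hence t can be chosen so that n - b t is an odd multiple of a (odd n) or twice one (even n), as
  Cauchy's lemma demands.\<close>

lemma summable_on_real_le:
  fixes f g :: "'a \<Rightarrow> real"
  assumes "g summable_on A" and "\<And>x. x \<in> A \<Longrightarrow> \<bar>f x\<bar> \<le> g x"
  shows "f summable_on A"
  by (rule abs_summable_summable, rule abs_summable_on_comparison_test'[OF assms(1)])
     (use assms(2) in auto)

lemma summable_on_real_Times:
  fixes f :: "'a \<Rightarrow> real" and g :: "'b \<Rightarrow> real"
  assumes "f summable_on A" and "g summable_on B"
  shows "(\<lambda>(x, y). f x * g y) summable_on A \<times> B"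
proof -
  have f: "(\<lambda>x. \<bar>f x\<bar>) summable_on A" and g: "(\<lambda>x. \<bar>g x\<bar>) summable_on B"
    using assms summable_on_iff_abs_summable_on_real by (metis (no_types, lifting) real_norm_def summable_on_cong)+
  have "(\<lambda>p. f (fst p) * g (snd p)) abs_summable_on A \<times> B"
    unfolding abs_summable_on_Sigma_iff
    by (auto simp: abs_mult infsum_cmult_right' intro!: summable_on_cmult_right summable_on_cmult_left f g)
  from abs_summable_summable[OF this] show ?thesis
    by (simp add: case_prod_beta')
qed

lemma infsum_real_Times:
  fixes f :: "'a \<Rightarrow> real" and g :: "'b \<Rightarrow> real"
  assumes "f summable_on A" and "g summable_on B"
  shows "infsum (\<lambda>(x, y). f x * g y) (A \<times> B) = infsum f A * infsum g B"
proof -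
  have "infsum (\<lambda>(x, y). f x * g y) (A \<times> B) = (\<Sum>\<^sub>\<infinity>x\<in>A. \<Sum>\<^sub>\<infinity>y\<in>B. f x * g y)"
    using infsum_Sigma'_banach[OF summable_on_real_Times[OF assms]] by simp
  also have "\<dots> = infsum f A * infsum g B"
    by (simp add: infsum_cmult_right' infsum_cmult_left')
  finally show ?thesis .
qed

lemma infsum_diff_real:
  fixes f g :: "'a \<Rightarrow> real"
  assumes "f summable_on A" and "g summable_on A"
  shows "(\<Sum>\<^sub>\<infinity>x\<in>A. f x - g x) = infsum f A - infsum g A"
  using infsum_add[OF assms(1), of "\<lambda>x. - g x"] assms(2) by (simp add: infsum_uminus summable_on_uminus)

lemma summable_on_diff_real:
  fixes f g :: "'a \<Rightarrow> real"
  assumes "f summable_on A" and "g summable_on A"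
  shows "(\<lambda>x. f x - g x) summable_on A"
  using summable_on_add[OF assms(1), of "\<lambda>x. - g x"] assms(2) by (simp add: summable_on_uminus)

lemma summable_on_geometric:
  fixes a :: real
  assumes "0 \<le> a" and "a < 1"
  shows "(\<lambda>n. a ^ n) summable_on (UNIV :: nat set)"
  by (rule summable_nonneg_imp_summable_on) (use assms in \<open>auto intro!: summable_geometric\<close>)

lemma infsum_geometric:
  fixes a :: real
  assumes "\<bar>a\<bar> < 1"
  shows "(\<Sum>\<^sub>\<infinity>n. a ^ n) = 1 / (1 - a)"
proof -
  have "((\<lambda>n. a ^ n) has_sum (1 / (1 - a))) (UNIV :: nat set)"
    by (rule norm_summable_imp_has_sum)
       (use assms in \<open>auto intro!: summable_geometric geometric_sums simp: power_abs\<close>)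
  then show ?thesis by (rule infsumI)
qed

lemma infsum_int_shift: "(\<Sum>\<^sub>\<infinity>n. f (n + k)) = (\<Sum>\<^sub>\<infinity>n. f (n :: int))"
  by (rule infsum_reindex_bij_betw) (rule bij_betw_byWitness[where f' = "\<lambda>n. n - k"]; simp)

lemma summable_on_int_shift: "(\<lambda>n. f (n + k)) summable_on UNIV \<longleftrightarrow> f summable_on (UNIV :: int set)"
  by (rule summable_on_reindex_bij_betw) (rule bij_betw_byWitness[where f' = "\<lambda>n. n - k"]; simp)

lemma infsum_int_reflect: "(\<Sum>\<^sub>\<infinity>n. f (k - n)) = (\<Sum>\<^sub>\<infinity>n. f (n :: int))"
  by (rule infsum_reindex_bij_betw) (rule bij_betw_byWitness[where f' = "\<lambda>n. k - n"]; simp)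

text \<open>Reflection about k/2. Odd k is the typical case below: the alternating sign then changes
  under n -> k - n.\<close>

lemma infsum_int_antisym:
  fixes f :: "int \<Rightarrow> real"
  assumes "\<And>n. f (k - n) = - f n"
  shows "infsum f UNIV = 0"
  using infsum_int_reflect[of f k] unfolding assms infsum_uminus by simp

lemma int_UNIV_split: "(UNIV :: int set) = insert 0 (range (\<lambda>n. int (Suc n)) \<union> range (\<lambda>n. - int (Suc n)))"
proof -
  have "x \<in> range (\<lambda>n. int (Suc n)) \<or> x = 0 \<or> x \<in> range (\<lambda>n. - int (Suc n))" for x :: int
  proof (cases x rule: int_cases3)
    case (pos n)
    then show ?thesis by (intro disjI1 image_eqI[of _ _ "n - 1"]) auto
  next
    case (neg n)
    then show ?thesis by (intro disjI2 image_eqI[of _ _ "n - 1"]) auto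
  qed simp
  then show ?thesis by auto
qed

lemma has_sum_int_iff_nat:
  fixes f :: "int \<Rightarrow> real"
  assumes "((\<lambda>n. f (int (Suc n))) has_sum A) UNIV" and "((\<lambda>n. f (- int (Suc n))) has_sum B) UNIV"
  shows "(f has_sum (f 0 + A + B)) UNIV"
proof -
  have 1: "(f has_sum A) (range (\<lambda>n. int (Suc n)))"
    using assms(1) by (subst has_sum_reindex) (auto simp: o_def inj_on_def)
  have 2: "(f has_sum B) (range (\<lambda>n. - int (Suc n)))"
    using assms(2) by (subst has_sum_reindex) (auto simp: o_def inj_on_def)
  have "(f has_sum (A + B)) (range (\<lambda>n. int (Suc n)) \<union> range (\<lambda>n. - int (Suc n)))"
    by (rule has_sum_Un_disjoint[OF 1 2]) auto
  then have "(f has_sum (f 0 + (A + B))) (insert 0 (range (\<lambda>n. int (Suc n)) \<union> range (\<lambda>n. - int (Suc n))))"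
    by (intro has_sum_insert) auto
  then show ?thesis by (simp only: int_UNIV_split[symmetric] add.assoc)
qed

lemma has_sum_int_even_odd:
  fixes f :: "int \<Rightarrow> real"
  assumes "((\<lambda>n. f (2 * n)) has_sum A) UNIV" and "((\<lambda>n. f (2 * n + 1)) has_sum B) UNIV"
  shows "(f has_sum (A + B)) UNIV"
proof -
  have "x \<in> range (\<lambda>n. 2 * n) \<union> range (\<lambda>n. 2 * n + 1)" for x :: int
    by (cases "even x") (auto elim!: evenE oddE)
  then have U: "range (\<lambda>n. 2 * n) \<union> range (\<lambda>n. 2 * n + 1) = (UNIV :: int set)"
    by blast
  have 1: "(f has_sum A) (range (\<lambda>n. 2 * n))"
    using assms(1) by (subst has_sum_reindex) (auto simp: o_def inj_on_def)
  have 2: "(f has_sum B) (range (\<lambda>n. 2 * n + 1))"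
    using assms(2) by (subst has_sum_reindex) (auto simp: o_def inj_on_def)
  have "(f has_sum (A + B)) (range (\<lambda>n. 2 * n) \<union> range (\<lambda>n. 2 * n + 1))"
    by (rule has_sum_Un_disjoint[OF 1 2]) (auto, presburger)
  then show ?thesis unfolding U .
qed

lemma summable_on_int_affine:
  fixes f :: "int \<Rightarrow> real"
  assumes "f summable_on UNIV" and "m \<noteq> 0"
  shows "(\<lambda>n. f (m * n + k)) summable_on UNIV"
proof -
  have "f summable_on range (\<lambda>n. m * n + k)"
    by (rule summable_on_subset_banach[OF assms(1)]) simp
  then show ?thesis
    using assms(2) by (subst (asm) summable_on_reindex) (auto simp: o_def inj_on_def)
qed

lemma has_sum_diff_real:
  fixes f g :: "'a \<Rightarrow> real"
  assumes "(f has_sum a) A" and "(g has_sum b) A"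
  shows "((\<lambda>x. f x - g x) has_sum (a - b)) A"
  using has_sum_add[OF assms(1), of "\<lambda>x. - g x" "- b"] assms(2) by (simp add: has_sum_uminus)

lemma has_sum_nat_Suc:
  fixes f :: "nat \<Rightarrow> real"
  assumes "((\<lambda>n. f (Suc n)) has_sum S) UNIV"
  shows "(f has_sum (f 0 + S)) UNIV"
proof -
  have UN: "(UNIV :: nat set) = insert 0 (range Suc)"
    using UNIV_nat_eq by blast
  have "(f has_sum S) (range Suc)"
    using assms by (subst has_sum_reindex) (simp_all add: o_def)
  then show ?thesis
    by (subst UN) (rule has_sum_insert, auto)
qed

lemma infsum_alternating_geometric:
  fixes x :: real
  assumes "0 \<le> x" and "x < 1"
  shows "(\<Sum>\<^sub>\<infinity>n. (-1) ^ n * x ^ n) = 1 / (1 + x)"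
    and "(\<lambda>n. (-1) ^ n * x ^ n) summable_on UNIV"
proof -
  have e: "(-1) ^ n * x ^ n = (- x) ^ n" for n
    by (simp add: power_minus[of x])
  show "(\<Sum>\<^sub>\<infinity>n. (-1) ^ n * x ^ n) = 1 / (1 + x)"
    unfolding e using infsum_geometric[of "- x"] assms by simp
  show "(\<lambda>n. (-1) ^ n * x ^ n) summable_on UNIV"
    by (rule summable_on_real_le[OF summable_on_geometric[OF assms]]) (simp add: abs_mult power_abs assms)
qed

definition sg :: "int \<Rightarrow> real" where "sg n = (if even n then 1 else -1)"

lemma sg_add [simp]: "sg (m + n) = sg m * sg n" and sg_diff [simp]: "sg (m - n) = sg m * sg n"
  by (cases "even m"; cases "even n"; simp add: sg_def)+

lemma sg_simps [simp]:
  "sg 0 = 1" "sg (- n) = sg n"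
  "sg n * sg n = 1" "sg n * (sg n * x) = x" "sg (2 * n) = 1" "sg (n * 2) = 1" "sg 1 = -1" "sg (numeral (num.Bit0 k)) = 1"
  "\<bar>sg n\<bar> = 1"
  by (auto simp: sg_def)

lemma sg_int: "sg (int n) = (-1) ^ n"
  by (auto simp: sg_def)

lemma infsum_int_convolution:
  fixes f g :: "int \<Rightarrow> real"
  assumes "f summable_on UNIV" and "g summable_on UNIV"
  shows "(\<Sum>\<^sub>\<infinity>k. \<Sum>\<^sub>\<infinity>l. f l * g (k - l)) = infsum f UNIV * infsum g UNIV"
proof -
  have b: "bij_betw (\<lambda>(k, l). (l, k - l)) (UNIV \<times> UNIV) (UNIV \<times> (UNIV :: int set))"
    by (rule bij_betw_byWitness[where f' = "\<lambda>(l, m). (l + m, l)"]) auto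
  have s: "(\<lambda>(k, l). f l * g (k - l)) summable_on UNIV \<times> UNIV"
    using summable_on_real_Times[OF assms] summable_on_reindex_bij_betw[OF b, of "\<lambda>(l, m). f l * g m"]
    by (simp add: case_prod_beta')
  have "(\<Sum>\<^sub>\<infinity>k. \<Sum>\<^sub>\<infinity>l. f l * g (k - l)) = infsum (\<lambda>(k, l). f l * g (k - l)) (UNIV \<times> UNIV)"
    using infsum_Sigma'_banach[OF s] by simp
  also have "\<dots> = infsum (\<lambda>(l, m). f l * g m) (UNIV \<times> UNIV)"
    using infsum_reindex_bij_betw[OF b, of "\<lambda>(l, m). f l * g m"] by (simp add: case_prod_beta')
  finally show ?thesis using infsum_real_Times[OF assms] by simp
qed

text \<open>(u, v) -> (u + v, u - v) is a bijection onto the pairs of equal parity. On these x^2 +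
  y^2 = 2(u^2 + v^2), which is how q^2 enters.\<close>

lemma infsum_int_pairs_same_parity:
  fixes F :: "int \<times> int \<Rightarrow> real"
  assumes "\<And>x y. odd (x + y) \<Longrightarrow> F (x, y) = 0"
  shows "infsum F (UNIV \<times> UNIV) = infsum (\<lambda>(u, v). F (u + v, u - v)) (UNIV \<times> UNIV)"
proof -
  let ?h = "\<lambda>(u, v). (u + v, u - v) :: int \<times> int"
  have "inj ?h" by (auto simp: inj_on_def)
  then have "infsum F (range ?h) = infsum (F \<circ> ?h) UNIV"
    by (rule infsum_reindex)
  moreover have "infsum F (range ?h) = infsum F (UNIV \<times> UNIV)"
  proof (rule infsum_cong_neutral)
    fix p :: "int \<times> int"
    assume p: "p \<in> UNIV \<times> UNIV - range ?h"
    obtain x y where xy: "p = (x, y)" by (cases p)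
    have "odd (x + y)"
    proof
      assume "even (x + y)"
      then obtain c where "x + y = 2 * c" ..
      then have "p = ?h (c, x - c)" using xy by simp
      with p show False by blast
    qed
    with assms xy show "F p = 0" by simp
  qed auto
  ultimately show ?thesis by (simp add: o_def case_prod_beta')
qed

lemma infsum_triangle:
  fixes f :: "nat \<Rightarrow> nat \<Rightarrow> real"
  assumes "(\<lambda>(l, i). f l i) summable_on UNIV \<times> UNIV"
  shows "(\<Sum>\<^sub>\<infinity>k. \<Sum>l\<le>k. f l (k - l)) = infsum (\<lambda>(l, i). f l i) (UNIV \<times> UNIV)"
    and "(\<lambda>k. \<Sum>l\<le>k. f l (k - l)) summable_on UNIV"
proof -
  have b: "bij_betw (\<lambda>(k, l). (l, k - l)) (Sigma UNIV (\<lambda>k. {..k})) (UNIV \<times> (UNIV :: nat set))"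
    by (rule bij_betw_byWitness[where f' = "\<lambda>(l, m). (l + m, l)"]) auto
  have s: "(\<lambda>(k, l). f l (k - l)) summable_on Sigma UNIV (\<lambda>k. {..k})"
    using assms summable_on_reindex_bij_betw[OF b, of "\<lambda>(l, m). f l m"]
    by (simp add: case_prod_beta')
  show "(\<lambda>k. \<Sum>l\<le>k. f l (k - l)) summable_on UNIV"
    using summable_on_Sigma_banach[OF s] by simp
  have "(\<Sum>\<^sub>\<infinity>k. \<Sum>l\<le>k. f l (k - l)) = infsum (\<lambda>(k, l). f l (k - l)) (Sigma UNIV (\<lambda>k. {..k}))"
    using infsum_Sigma'_banach[OF s] by simp
  also have "\<dots> = infsum (\<lambda>(l, m). f l m) (UNIV \<times> UNIV)"
    using infsum_reindex_bij_betw[OF b, of "\<lambda>(l, m). f l m"] by (simp add: case_prod_beta')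
  finally show "(\<Sum>\<^sub>\<infinity>k. \<Sum>l\<le>k. f l (k - l)) = infsum (\<lambda>(l, i). f l i) (UNIV \<times> UNIV)" .
qed

text \<open>Summation by parts. \<open>L\<close> is the limit of f along the positive odd integers,
  so \<open>K - L\<close> is the limit on the negative side. The terms for j and -j agree, each half
  contributes 2X - x(0), and the term j = 0, equal to 2(x(0) + L) - K, cancels both boundary
  terms.\<close>

lemma infsum_int_alternating_odd:
  fixes f :: "int \<Rightarrow> real"
  assumes refl: "\<And>n. odd n \<Longrightarrow> f (- n) = K - f n"
    and s: "(\<lambda>n. f (2 * int n + 1) - L) summable_on UNIV"
  shows "(\<Sum>\<^sub>\<infinity>j. sg j * (f (2 * j + 1) - f (2 * j - 1))) = 2 * L - K + 4 * (\<Sum>\<^sub>\<infinity>n. (-1) ^ n * (f (2 * int n + 1) - L))"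
proof -
  define x where "x n = f (2 * int n + 1) - L" for n
  define X where "X = (\<Sum>\<^sub>\<infinity>n. (-1) ^ n * x n)"
  define F where "F j = sg j * (f (2 * j + 1) - f (2 * j - 1))" for j
  have sx: "(\<lambda>n. (-1) ^ n * x n) summable_on UNIV"
    using s unfolding x_def[symmetric] summable_on_iff_abs_summable_on_real[of x]
    by (rule summable_on_real_le) (simp add: abs_mult power_abs)
  then have X: "((\<lambda>n. (-1) ^ n * x n) has_sum X) UNIV"
    unfolding X_def by simp
  have "(\<lambda>n. (-1) ^ Suc n * x (Suc n)) summable_on UNIV"
    using summable_on_subset_banach[OF sx subset_UNIV, of "range Suc"]
    by (subst (asm) summable_on_reindex) (simp_all add: o_def)
  then have S: "((\<lambda>n. (-1) ^ Suc n * x (Suc n)) has_sum (\<Sum>\<^sub>\<infinity>n. (-1) ^ Suc n * x (Suc n))) UNIV"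
    by simp
  have "(\<Sum>\<^sub>\<infinity>n. (-1) ^ Suc n * x (Suc n)) = X - x 0"
    using has_sum_unique[OF X has_sum_nat_Suc[of "\<lambda>n. (-1) ^ n * x n", OF S]] by simp
  note S[unfolded this]
  from has_sum_add[OF this X]
  have *: "((\<lambda>n. (-1) ^ Suc n * (x (Suc n) - x n)) has_sum (2 * X - x 0)) UNIV"
    by (simp add: algebra_simps)
  have Fp: "F (int (Suc n)) = (-1) ^ Suc n * (x (Suc n) - x n)" for n
    unfolding F_def x_def by (simp add: sg_def algebra_simps)
  have Fm: "F (- j) = F j" for j
  proof -
    have e: "2 * (- j) + 1 = - (2 * j - 1)" "2 * (- j) - 1 = - (2 * j + 1)"
      by simp_all
    have r: "f (- (2 * j - 1)) = K - f (2 * j - 1)" "f (- (2 * j + 1)) = K - f (2 * j + 1)"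
      by (rule refl; simp)+
    show ?thesis unfolding F_def e r by simp
  qed
  have "(F has_sum (F 0 + (2 * X - x 0) + (2 * X - x 0))) UNIV"
    by (rule has_sum_int_iff_nat; unfold Fm Fp; rule *)
  moreover have "F 0 = 2 * (x 0 + L) - K"
    using refl[of 1] by (simp add: F_def x_def)
  ultimately have "infsum F UNIV = 2 * L - K + 4 * X"
    by (intro infsumI) (simp add: algebra_simps)
  then show ?thesis unfolding F_def X_def x_def .
qed

lemma sum_lessThan_double:
  fixes f :: "nat \<Rightarrow> real"
  shows "(\<Sum>r<2 * n. f r) = (\<Sum>l<n. f (2 * l)) + (\<Sum>l<n. f (2 * l + 1))"
  by (induction n) auto

lemma recip_plus_inverse_square:
  fixes r :: real
  assumes "0 < r"
  shows "r / (1 + r * r) * (inverse (r * r) + 1) = inverse r"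
    and "inverse r / (1 + inverse (r * r)) = r / (1 + r * r)"
proof -
  have nz: "1 + r * r \<noteq> 0" "1 + inverse (r * r) \<noteq> 0"
    using mult_pos_pos[OF assms assms] positive_imp_inverse_positive[of "r * r"] by linarith+
  have "inverse (r * r) + 1 = (1 + r * r) * inverse (r * r)"
    using assms by (simp add: distrib_right del: inverse_mult_distrib)
  then have "r / (1 + r * r) * (inverse (r * r) + 1) = r * inverse (r * r)"
    using nz(1) by simp
  also have "\<dots> = inverse r"
    using assms by (simp add: inverse_mult_distrib)
  finally show *: "r / (1 + r * r) * (inverse (r * r) + 1) = inverse r" .
  show "inverse r / (1 + inverse (r * r)) = r / (1 + r * r)"
    unfolding nonzero_divide_eq_eq[OF nz(2)] using * by (simp only: add.commute)
qed

subsection \<open>Exponentially decaying families\<close>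

text \<open>Since \<open>nat n\<close> is 0 for negative n, this means exponential decay at plus
  infinity together with boundedness on the negative side. A product is then summable when each
  factor decays at one of the two ends.\<close>

definition pos_decay :: "(int \<Rightarrow> real) \<Rightarrow> bool" where
  "pos_decay f \<longleftrightarrow> (\<exists>C a. 0 < a \<and> a < 1 \<and> (\<forall>n. \<bar>f n\<bar> \<le> C * a ^ nat n))"

definition bdd_fun :: "(int \<Rightarrow> real) \<Rightarrow> bool" where
  "bdd_fun f \<longleftrightarrow> (\<exists>C. \<forall>n. \<bar>f n\<bar> \<le> C)"

definition neg_decay :: "(int \<Rightarrow> real) \<Rightarrow> bool" where
  "neg_decay f \<longleftrightarrow> pos_decay (\<lambda>n. f (- n))"

lemma pos_decayI: "0 < a \<Longrightarrow> a < 1 \<Longrightarrow> (\<And>n. \<bar>f n\<bar> \<le> C * a ^ nat n) \<Longrightarrow> pos_decay f"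
  unfolding pos_decay_def by blast

lemma pos_decayE:
  assumes "pos_decay f"
  obtains C a where "0 < a" "a < 1" "0 \<le> C" "\<And>n. \<bar>f n\<bar> \<le> C * a ^ nat n"
proof -
  obtain C a where *: "0 < a" "a < 1" "\<And>n. \<bar>f n\<bar> \<le> C * a ^ nat n"
    using assms unfolding pos_decay_def by blast
  from *(3)[of 0] have "0 \<le> C" by simp
  with * that show ?thesis by blast
qed

lemma pos_decay_bdd: "pos_decay f \<Longrightarrow> bdd_fun f"
proof (elim pos_decayE)
  fix C a :: real
  assume *: "0 < a" "a < 1" "0 \<le> C" "\<And>n. \<bar>f n\<bar> \<le> C * a ^ nat n"
  have "\<bar>f n\<bar> \<le> C * 1" for n
    using *(4)[of n] mult_left_mono[OF power_le_one[of a "nat n"], of C] * by linarith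
  then show "bdd_fun f" unfolding bdd_fun_def by blast
qed

lemma pos_decay_add:
  assumes "pos_decay f" and "pos_decay g"
  shows "pos_decay (\<lambda>n. f n + g n)"
proof -
  obtain C a where f: "0 < a" "a < 1" "0 \<le> C" "\<And>n. \<bar>f n\<bar> \<le> C * a ^ nat n"
    using pos_decayE[OF assms(1)] by blast
  obtain D b where g: "0 < b" "b < 1" "0 \<le> D" "\<And>n. \<bar>g n\<bar> \<le> D * b ^ nat n"
    using pos_decayE[OF assms(2)] by blast
  show ?thesis
  proof (rule pos_decayI[of "max a b" _ "C + D"])
    fix n
    have "C * a ^ nat n \<le> C * max a b ^ nat n" "D * b ^ nat n \<le> D * max a b ^ nat n"
      using f g by (auto intro!: mult_left_mono power_mono)
    then show "\<bar>f n + g n\<bar> \<le> (C + D) * max a b ^ nat n"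
      using f(4)[of n] g(4)[of n] abs_triangle_ineq[of "f n" "g n"] unfolding distrib_right by linarith
  qed (use f g in auto)
qed

lemma pos_decay_mult:
  assumes "pos_decay f" and "bdd_fun g"
  shows "pos_decay (\<lambda>n. f n * g n)"
proof -
  obtain C a where f: "0 < a" "a < 1" "0 \<le> C" "\<And>n. \<bar>f n\<bar> \<le> C * a ^ nat n"
    using pos_decayE[OF assms(1)] by blast
  obtain D where g: "\<And>n. \<bar>g n\<bar> \<le> D"
    using assms(2) unfolding bdd_fun_def by blast
  show ?thesis
  proof (rule pos_decayI[of a _ "C * D"])
    fix n
    have "\<bar>f n * g n\<bar> \<le> (C * a ^ nat n) * D"
      unfolding abs_mult by (intro mult_mono f g) (use f in auto)
    then show "\<bar>f n * g n\<bar> \<le> C * D * a ^ nat n" by (simp add: mult_ac)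
  qed (use f in auto)
qed

lemma pos_decay_shift:
  assumes "pos_decay f"
  shows "pos_decay (\<lambda>n. f (n + k))"
proof -
  obtain C a where f: "0 < a" "a < 1" "0 \<le> C" "\<And>n. \<bar>f n\<bar> \<le> C * a ^ nat n"
    using pos_decayE[OF assms(1)] by blast
  show ?thesis
  proof (rule pos_decayI[of a _ "C / a ^ nat (- k)"])
    fix n
    have "a ^ nat (n + k) * a ^ nat (- k) \<le> a ^ nat n"
      unfolding power_add[symmetric] using f by (intro power_decreasing) auto
    then have "a ^ nat (n + k) \<le> a ^ nat n / a ^ nat (- k)"
      using f by (simp add: field_simps)
    from mult_left_mono[OF this f(3)] f(4)[of "n + k"]
    show "\<bar>f (n + k)\<bar> \<le> C / a ^ nat (- k) * a ^ nat n" by simp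
  qed (use f in auto)
qed

lemma bdd_funI: "(\<And>n. \<bar>f n\<bar> \<le> C) \<Longrightarrow> bdd_fun f"
  unfolding bdd_fun_def by blast

lemma bdd_fun_const: "bdd_fun (\<lambda>n. c)"
  by (rule bdd_funI[of _ "\<bar>c\<bar>"]) simp

lemma bdd_fun_comp: "bdd_fun f \<Longrightarrow> bdd_fun (\<lambda>n. f (g n))"
  unfolding bdd_fun_def by blast

lemma neg_decay_add: "neg_decay f \<Longrightarrow> neg_decay g \<Longrightarrow> neg_decay (\<lambda>n. f n + g n)"
  unfolding neg_decay_def by (rule pos_decay_add)

lemma neg_decay_mult: "neg_decay f \<Longrightarrow> bdd_fun g \<Longrightarrow> neg_decay (\<lambda>n. f n * g n)"
  unfolding neg_decay_def by (rule pos_decay_mult[OF _ bdd_fun_comp])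

lemma neg_decay_shift: "neg_decay f \<Longrightarrow> neg_decay (\<lambda>n. f (n + k))"
  unfolding neg_decay_def using pos_decay_shift[of "\<lambda>n. f (- n)" "- k"] by (simp add: algebra_simps)

lemma neg_decay_bdd: "neg_decay f \<Longrightarrow> bdd_fun f"
  unfolding neg_decay_def by (drule pos_decay_bdd, drule bdd_fun_comp[of _ uminus]) simp

lemma decay_summable:
  assumes "pos_decay f" and "neg_decay f"
  shows "f summable_on UNIV"
proof -
  have *: "(\<lambda>n. g (int (Suc n))) summable_on UNIV" if g: "pos_decay g" for g
  proof -
    obtain C a where f: "0 < a" "a < 1" "0 \<le> C" "\<And>n. \<bar>g n\<bar> \<le> C * a ^ nat n"
      using pos_decayE[OF g] by blast
    have "(\<lambda>n. C * a * a ^ n) summable_on (UNIV :: nat set)"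
      using f by (intro summable_on_cmult_right summable_on_geometric) auto
    moreover have "\<bar>g (int (Suc n))\<bar> \<le> C * a * a ^ n" for n
      using f(4)[of "int (Suc n)"] by (simp only: nat_int power_Suc mult.assoc)
    ultimately show ?thesis
      by (rule summable_on_real_le)
  qed
  from *[OF assms(1)] *[OF assms(2)[unfolded neg_decay_def]] show ?thesis
    using has_sum_int_iff_nat[of f] unfolding summable_on_def by blast
qed

lemma pos_decay_uminus: "pos_decay f \<Longrightarrow> pos_decay (\<lambda>n. - f n)"
  unfolding pos_decay_def by simp

subsection \<open>Coefficients of the Kronecker products\<close>

locale nome =
  fixes q :: real
  assumes q_pos: "0 < q" and q_lt_1: "q < 1"
begin

text \<open>Let \<open>K x y\<close> be the sum of \<open>x^r y^s q^(r s)\<close> over \<open>r, s \<ge> 0\<close> minus the same sum over \<open>r, s < 0\<close>.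
  For \<open>q < \<bar>x\<bar> < 1\<close>, \<open>cn n\<close> is the coefficient of \<open>x^n\<close> in \<open>K (-x) (-x)\<close> and \<open>dn n\<close> is,
  up to sign, the coefficient of \<open>x^(-n)\<close> in \<open>K (1/x) (-1)\<close>. By Kronecker's theorem the product
  of the two series is a theta series, so its coefficients \<open>pn\<close> satisfy the two-term recurrence \<open>pn_rec\<close>.\<close>

definition dn :: "int \<Rightarrow> real" where
  "dn n = q powi n / (1 + q powi n)"

definition inner_sum :: "nat \<Rightarrow> real" where
  "inner_sum m = (\<Sum>r = 1..<m. q ^ (r * (m - r)))"

definition cn :: "int \<Rightarrow> real" where
  "cn n = sg n * (if n > 0 then 2 + inner_sum (nat n) else if n = 0 then 1 else - inner_sum (nat (- n)))"

definition theta :: "int \<Rightarrow> real" where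
  "theta n = q ^ nat (n * n)"

lemma q_simps [simp]: "q \<noteq> 0" "0 < q" "q < 1" "0 \<le> q" "q \<le> 1"
  using q_pos q_lt_1 by auto

lemma powi_pos [simp]: "0 < q powi n"
  by simp

lemma dn_pos: "0 < dn n"
  and dn_le_1: "dn n \<le> 1"
  and dn_le: "dn n \<le> q powi n"
proof -
  have "0 < q powi n" by simp
  then show "0 < dn n" "dn n \<le> 1" "dn n \<le> q powi n"
    unfolding dn_def by (auto simp: field_simps add_pos_pos)
qed

lemma dn_minus: "dn (- n) = 1 - dn n"
proof -
  have "0 < q powi n" by simp
  then have "1 + q powi n \<noteq> 0" by linarith
  then show ?thesis unfolding dn_def power_int_minus by (simp add: field_simps)
qed

lemma dn_eq: "(1 + q powi n) * dn n = q powi n"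
proof -
  have "0 < q powi n" by simp
  then have "1 + q powi n \<noteq> 0" by linarith
  then show ?thesis unfolding dn_def by simp
qed

lemma cn_minus: "cn (- n) = 2 * sg n - cn n"
  by (auto simp: cn_def algebra_simps)

text \<open>Shifting r by one uses (r + 1)(m + 1 - r) = r(m - r) + (m + 1). The end terms r = 0 and
  r = m supply the 2; for m = 0 they coincide, which is why \<open>cn 0\<close> is 1.\<close>

lemma inner_sum_rec:
  assumes "1 \<le> m"
  shows "inner_sum (m + 2) = q ^ (m + 1) * (2 + inner_sum m)"
proof -
  have e: "Suc r * (m + 2 - Suc r) = (m + 1) + r * (m - r)" if r: "r < Suc m" for r
  proof -
    obtain j where j: "m = r + j" using r le_Suc_ex[of r m] by auto
    have "m + 2 - Suc r = Suc j" "m - r = j" using j by auto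
    then show ?thesis unfolding j by simp
  qed
  have "inner_sum (m + 2) = (\<Sum>r = 0..<Suc m. q ^ (Suc r * (m + 2 - Suc r)))"
    unfolding inner_sum_def by (subst sum.shift_bounds_Suc_ivl[symmetric]) simp
  also have "\<dots> = (\<Sum>r = 0..<Suc m. q ^ (m + 1) * q ^ (r * (m - r)))"
    by (intro sum.cong refl) (simp only: e power_add atLeastLessThan_iff)
  also have "\<dots> = q ^ (m + 1) * (\<Sum>r = 0..<Suc m. q ^ (r * (m - r)))"
    by (simp only: sum_distrib_left)
  also have "(\<Sum>r = 0..<Suc m. q ^ (r * (m - r))) = 2 + inner_sum m"
    using assms unfolding inner_sum_def by (simp add: sum.atLeast_Suc_lessThan)
  finally show ?thesis .
qed

lemma cn_rec_nonneg:
  assumes "0 \<le> n"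
  shows "cn (n + 2) = q powi (n + 1) * cn n + 2 * sg n"
proof (cases "n = 0")
  case True
  then show ?thesis by (simp add: cn_def inner_sum_def numeral_2_eq_2)
next
  case False
  then obtain m where m: "n = int m" "1 \<le> m"
    using assms by (metis One_nat_def Suc_leI gr0I nonneg_eq_int of_nat_0)
  have "nat (int m + 2) = m + 2" by simp
  moreover have "q powi (int m + 1) = q ^ (m + 1)"
    using power_int_of_nat[of q "m + 1"] by (simp only: of_nat_add of_nat_1)
  ultimately show ?thesis
    using m inner_sum_rec[OF m(2)] by (simp add: cn_def algebra_simps)
qed

lemma cn_rec: "cn (n + 2) = q powi (n + 1) * cn n + 2 * sg n"
proof (cases "0 \<le> n")
  case False
  show ?thesis
  proof (cases "n = -1")
    case True
    then show ?thesis by (simp add: cn_def inner_sum_def sg_def)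
  next
    case n: False
    \<comment> \<open>The reflection n -> -n - 2 carries the recurrence from m \<ge> 0 to n \<le>
      -2; its fixed point -1 was treated separately.\<close>
    define m where "m = - n - 2"
    have m: "0 \<le> m" "n = - (m + 2)" "n + 2 = - m" "sg n = sg m"
      using False n unfolding m_def by auto
    have *: "q powi (n + 1) * q powi (m + 1) = 1"
      by (subst power_int_add[symmetric]) (auto simp: m(2))
    have "q powi (n + 1) * cn n + 2 * sg n = 2 * sg m + q powi (n + 1) * (2 * sg m - cn (m + 2))"
      by (subst (2) m(2)) (simp only: cn_minus m(4), simp)
    also have "\<dots> = 2 * sg m - q powi (n + 1) * q powi (m + 1) * cn m"
      unfolding cn_rec_nonneg[OF m(1)] by (simp add: algebra_simps)
    also have "\<dots> = cn (n + 2)"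
      unfolding * m(3) cn_minus by simp
    finally show ?thesis ..
  qed
qed (rule cn_rec_nonneg)

lemma pos_decay_dn: "pos_decay dn"
proof (rule pos_decayI[of q _ 1])
  fix n
  show "\<bar>dn n\<bar> \<le> 1 * q ^ nat n"
    using dn_pos[of n] dn_le_1[of n] dn_le[of n] by (cases "0 \<le> n") (auto simp: power_int_def)
qed simp_all

lemma neg_decay_dn_minus: "neg_decay (\<lambda>n. dn (- n))"
  unfolding neg_decay_def using pos_decay_dn by simp

lemma inner_sum_nonneg: "0 \<le> inner_sum m"
  unfolding inner_sum_def by (intro sum_nonneg) simp

lemma inner_sum_decay: "\<exists>C a. 0 < a \<and> a < 1 \<and> 0 \<le> C \<and> (\<forall>m. inner_sum m \<le> C * a ^ m)"
proof -
  \<comment> \<open>There are fewer than m terms, each at most q^(m - 1) because r(m - r) \<ge> m -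
    1. With a = sqrt q the bound m q^m splits as (m a^m) a^m, and the first factor is
    bounded.\<close>
  define a where "a = sqrt q"
  have a: "0 < a" "a < 1" "a * a = q"
    using q_pos q_lt_1 by (auto simp: a_def)
  have "(\<lambda>m. real m * a ^ m) \<longlonglongrightarrow> 0"
    by (rule powser_times_n_limit_0) (use a in auto)
  then have "Bseq (\<lambda>m. real m * a ^ m)"
    by (intro convergent_imp_Bseq) (auto simp: convergent_def)
  then obtain K where K: "0 < K" "\<And>m. norm (real m * a ^ m) \<le> K"
    by (auto simp: Bseq_def)
  have "inner_sum m \<le> (K / q) * a ^ m" for m
  proof (cases "m = 0")
    case False
    have "inner_sum m \<le> (\<Sum>r = 1..<m. q ^ (m - 1))"
      unfolding inner_sum_def
    proof (rule sum_mono)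
      fix r assume r: "r \<in> {1..<m}"
      then obtain j where j: "m = r + j" "1 \<le> j" by (metis Suc_leI atLeastLessThan_iff less_imp_add_positive One_nat_def)
      have "m - 1 \<le> r * (m - r)"
      proof -
        obtain i where "r = Suc i" using r by (metis atLeastLessThan_iff not0_implies_Suc not_one_le_zero)
        moreover obtain k where "j = Suc k" using j by (metis not0_implies_Suc not_one_le_zero)
        ultimately show ?thesis using j by simp
      qed
      then show "q ^ (r * (m - r)) \<le> q ^ (m - 1)"
        by (intro power_decreasing) auto
    qed
    also have "\<dots> \<le> real m * q ^ (m - 1)"
      by (simp add: mult_right_mono)
    also have "\<dots> = (real m * a ^ m) * a ^ m / q"
    proof -
      have "a ^ m * a ^ m = q * q ^ (m - 1)"
        unfolding power_mult_distrib[symmetric] a(3) using False by (simp add: power_eq_if)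
      then have "q ^ (m - 1) = a ^ m * a ^ m / q" by (simp add: field_simps)
      then show ?thesis by simp
    qed
    also have "\<dots> \<le> K * a ^ m / q"
      using K(2)[of m] a(1) by (intro divide_right_mono mult_right_mono) auto
    finally show ?thesis by simp
  qed (use K in \<open>simp add: inner_sum_def\<close>)
  then show ?thesis using a(1,2) K(1) by (intro exI[of _ "K / q"] exI[of _ a]) simp
qed

lemma neg_decay_cn: "neg_decay cn"
proof -
  obtain C a where *: "0 < a" "a < 1" "0 \<le> C" "\<And>m. inner_sum m \<le> C * a ^ m"
    using inner_sum_decay by blast
  have **: "inner_sum m \<le> C" for m
    using *(4)[of m] mult_left_mono[OF power_le_one[of a m], of C] * by linarith
  show ?thesis unfolding neg_decay_def
  proof (rule pos_decayI[of a _ "C + 2"])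
    fix n :: int
    have "0 \<le> C * a ^ nat n" "0 \<le> a ^ nat n" using * by auto
    then show "\<bar>cn (- n)\<bar> \<le> (C + 2) * a ^ nat n"
      using *(4)[of "nat n"] inner_sum_nonneg[of "nat n"] **[of "nat (- n)"] inner_sum_nonneg[of "nat (- n)"]
      by (cases "0 < n") (auto simp: cn_def abs_mult distrib_right *(3))
  qed (use * in auto)
qed

lemma bdd_cn: "bdd_fun cn" and bdd_dn: "bdd_fun dn"
  using neg_decay_cn neg_decay_bdd pos_decay_dn pos_decay_bdd by auto

section \<open>The product coefficients and their theta recurrence\<close>

definition pn :: "int \<Rightarrow> real" where
  "pn k = (\<Sum>\<^sub>\<infinity>n. cn (n + k) * dn n)"

text \<open>\<open>cn\<close> decays only at minus infinity and \<open>dn\<close> only at plus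
  infinity; each is bounded at the other end.\<close>

lemma summable_pn: "(\<lambda>n. cn (n + k) * dn (n + l)) summable_on UNIV"
proof (rule decay_summable)
  show "pos_decay (\<lambda>n. cn (n + k) * dn (n + l))"
    using pos_decay_mult[OF pos_decay_shift[OF pos_decay_dn] bdd_fun_comp[OF bdd_cn]] by (simp add: mult.commute)
  show "neg_decay (\<lambda>n. cn (n + k) * dn (n + l))"
    by (rule neg_decay_mult[OF neg_decay_shift[OF neg_decay_cn] bdd_fun_comp[OF bdd_dn]])
qed

text \<open>The remainder when the recurrences of \<open>cn\<close> and \<open>dn\<close> are
  combined. The subtracted term cancels the oscillation of \<open>cn\<close> between values near 2
  and -2 at plus infinity, so that \<open>en k\<close> decays at both ends.\<close>

definition en :: "int \<Rightarrow> int \<Rightarrow> real" where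
  "en k n = cn (n + k) - 2 * sg (n + k) * dn (- n)"

lemma en_0_antisym: "en 0 (- n) = - en 0 n"
  by (simp add: en_def cn_minus[of n] dn_minus[of n] algebra_simps)

lemma neg_decay_en: "neg_decay (en k)"
proof -
  have "neg_decay (\<lambda>n. dn (- n) * (- (2 * sg (n + k))))"
    by (rule neg_decay_mult[OF neg_decay_dn_minus bdd_funI[of _ 2]]) (simp add: abs_mult)
  from neg_decay_add[OF neg_decay_shift[OF neg_decay_cn] this, of k] show ?thesis
    by (rule back_subst[of neg_decay]) (simp add: en_def mult_ac fun_eq_iff)
qed

lemma pos_decay_en: "pos_decay (en k)"
proof -
  have "pos_decay (\<lambda>n. cn (- n))"
    using neg_decay_cn by (simp add: neg_decay_def)
  from pos_decay_mult[OF pos_decay_shift[OF this, of k] bdd_fun_const[of "-1"]]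
  have 1: "pos_decay (\<lambda>n. cn (- (n + k)) * -1)" .
  have 2: "pos_decay (\<lambda>n. dn n * (2 * sg (n + k)))"
    by (rule pos_decay_mult[OF pos_decay_dn bdd_funI[of _ 2]]) (simp add: abs_mult)
  have "en k = (\<lambda>n. cn (- (n + k)) * -1 + dn n * (2 * sg (n + k)))"
    unfolding en_def dn_minus cn_minus by (rule ext) (simp add: algebra_simps)
  with pos_decay_add[OF 1 2] show ?thesis by (simp only:)
qed

lemma summable_en: "en k summable_on UNIV"
  by (rule decay_summable[OF pos_decay_en neg_decay_en])

text \<open>\<open>en 0\<close> is odd. In \<open>en (k + 1) (n - 1) - en k n\<close> the
  \<open>cn\<close> terms cancel, and the remaining difference of \<open>dn\<close> values changes
  sign under n -> 1 - n; hence the sum does not depend on k.\<close>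

lemma infsum_en: "infsum (en k) UNIV = 0"
proof -
  have step: "infsum (en (k + 1)) UNIV = infsum (en k) UNIV" for k
  proof -
    have 1: "infsum (en (k + 1)) UNIV = (\<Sum>\<^sub>\<infinity>n. en (k + 1) (n - 1))"
      using infsum_int_shift[of "en (k + 1)" "-1"] by simp
    have s: "(\<lambda>n. en (k + 1) (n - 1)) summable_on UNIV"
      using summable_en[of "k + 1"] summable_on_int_shift[of "en (k + 1)" "-1"] by simp
    have "infsum (en (k + 1)) UNIV - infsum (en k) UNIV = (\<Sum>\<^sub>\<infinity>n. en (k + 1) (n - 1) - en k n)"
      unfolding 1 by (rule infsum_diff_real[OF s summable_en, symmetric])
    also have "\<dots> = 0"
    proof (rule infsum_int_antisym[where k = 1])
      fix n
      have d: "dn (1 - n) = 1 - dn (n - 1)" "dn (- n) = 1 - dn n"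
        using dn_minus[of "n - 1"] dn_minus[of n] by simp_all
      show "en (k + 1) (1 - n - 1) - en k (1 - n) = - (en (k + 1) (n - 1) - en k n)"
        unfolding en_def by (simp add: d) (simp add: algebra_simps)
    qed
    finally show ?thesis by simp
  qed
  show ?thesis
  proof (induction k rule: int_induct[where k = 0])
    case base
    show ?case by (rule infsum_int_antisym[where k = 0]) (simp add: en_0_antisym)
  next
    case (step2 i)
    then show ?case using step[of "i - 1"] by simp
  qed (simp add: step)
qed

text \<open>By \<open>dn_eq\<close>, dn(n) = q^n (1 - dn(n)) = q^n dn(-n). Inserting this in the
  second product and applying \<open>cn_rec\<close> makes the terms with
  \<open>cn (n + k + 2)\<close> add up to a single one, and the summand becomes
  \<open>en (k + 2) n\<close>.\<close>

lemma pn_rec: "pn (k + 2) = - (q powi (k + 1)) * pn k"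
proof -
  have s: "(\<lambda>n. cn (n + k) * dn n) summable_on UNIV" for k
    using summable_pn[of k 0] by simp
  have "pn (k + 2) + q powi (k + 1) * pn k
      = (\<Sum>\<^sub>\<infinity>n. cn (n + (k + 2)) * dn n + q powi (k + 1) * (cn (n + k) * dn n))"
    unfolding pn_def infsum_cmult_right'[symmetric]
    by (rule infsum_add[symmetric]) (intro s summable_on_cmult_right)+
  also have "\<dots> = infsum (en (k + 2)) UNIV"
  proof (rule infsum_cong)
    fix n
    have "cn (n + (k + 2)) = q powi (k + 1) * (q powi n * cn (n + k)) + 2 * sg (n + k)"
      using cn_rec[of "n + k"] by (simp add: power_int_add add.assoc[symmetric] mult_ac)
    moreover have "q powi n = dn n + q powi n * dn n"
      using dn_eq[of n] by (simp add: algebra_simps)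
    ultimately show "cn (n + (k + 2)) * dn n + q powi (k + 1) * (cn (n + k) * dn n) = en (k + 2) n"
      unfolding en_def dn_minus by simp algebra
  qed
  finally show ?thesis unfolding infsum_en by simp
qed

lemma theta_rec: "theta (m + 1) = q powi (2 * m + 1) * theta m"
proof -
  have "theta n = q powi (n * n)" for n
    unfolding theta_def by (simp add: power_int_def)
  then show ?thesis
    by (simp add: power_int_add[symmetric] algebra_simps)
qed

text \<open>The recurrence runs in both directions because powers of q do not vanish, so its
  solutions form a line spanned by the alternating theta coefficients. It identifies both
  \<open>pn\<close> at even arguments and \<open>hn\<close>.\<close>

lemma theta_quasi:
  assumes "\<And>m. f (m + 1) = - (q powi (2 * m + 1)) * f m"
  shows "f m = sg m * theta m * f 0"
proof (induction m rule: int_induct[where k = 0])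
  case (step1 i)
  then show ?case by (simp add: assms theta_rec)
next
  case (step2 i)
  define r where "r = q powi (2 * (i - 1) + 1)"
  have "r \<noteq> 0" by (simp add: r_def)
  have "- r * f (i - 1) = sg i * theta i * f 0"
    using assms[of "i - 1"] step2 by (simp add: r_def)
  also have "\<dots> = - r * (sg (i - 1) * theta (i - 1) * f 0)"
    using theta_rec[of "i - 1"] by (simp add: r_def)
  finally show ?case
    unfolding mult_cancel_left using \<open>r \<noteq> 0\<close> by simp
qed (simp add: theta_def)

lemma pn_even: "pn (2 * m) = sg m * theta m * pn 0"
  using theta_quasi[of "\<lambda>m. pn (2 * m)"] pn_rec[of "2 * _"] by (simp add: algebra_simps)

subsection \<open>Jacobi's two-square theorem\<close>

lemma nome_square: "nome (q\<^sup>2)"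
  using q_pos q_lt_1 by unfold_locales (auto simp: power_less_one_iff)

text \<open>This is 1/(q^l + q^(-l)), an even function of l, which permits sums over all
  integers.\<close>

definition gn :: "int \<Rightarrow> real" where
  "gn l = q powi l / (1 + q powi (2 * l))"

definition theta3 :: real where "theta3 = (\<Sum>\<^sub>\<infinity>n. theta n)"
definition theta4 :: real where "theta4 = (\<Sum>\<^sub>\<infinity>n. sg n * theta n)"
text \<open>\<open>lambert_plus\<close> is the Lambert series of \<open>theta3^2\<close> in Jacobi's two-square theorem, and \<open>lambert_minus\<close> is
  the same series at \<open>-q\<close>.\<close>

definition lambert_plus :: real where "lambert_plus = 2 * (\<Sum>\<^sub>\<infinity>l. gn l)"
definition lambert_minus :: real where "lambert_minus = 2 * (\<Sum>\<^sub>\<infinity>l. sg l * gn l)"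

lemma qp_add: "q powi (m + n) = q powi m * q powi n"
  by (simp add: power_int_add)

lemma theta_minus [simp]: "theta (- n) = theta n"
  by (simp add: theta_def)

lemma theta_0 [simp]: "theta 0 = 1"
  by (simp add: theta_def)

lemma theta_pos: "0 < theta n"
  by (simp add: theta_def)

lemma theta_le: "theta n \<le> q ^ nat \<bar>n\<bar>"
proof -
  have "1 * \<bar>n\<bar> \<le> \<bar>n\<bar> * \<bar>n\<bar>"
    by (cases "n = 0") (simp, intro mult_right_mono, auto)
  then have "nat \<bar>n\<bar> \<le> nat (n * n)" by (intro nat_mono) simp
  then show ?thesis unfolding theta_def by (intro power_decreasing) auto
qed

lemma gn_minus [simp]: "gn (- n) = gn n"
proof -
  define r where "r = q powi n"
  have r: "0 < r" by (simp add: r_def)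
  have *: "q powi (2 * n) = r * r" "q powi (2 * - n) = inverse (r * r)" "q powi (- n) = inverse r"
    unfolding r_def qp_add[symmetric] power_int_minus[symmetric] by simp_all
  show ?thesis unfolding gn_def * r_def[symmetric] by (rule recip_plus_inverse_square(2)[OF r])
qed

lemma gn_pos: "0 < gn n"
proof -
  have "0 < q powi (2 * n)" by (rule powi_pos)
  then have "0 < 1 + q powi (2 * n)" by linarith
  then show ?thesis unfolding gn_def by (intro divide_pos_pos powi_pos)
qed

lemma gn_le: "gn n \<le> q ^ nat \<bar>n\<bar>"
proof -
  have "gn n \<le> q ^ nat n" if "0 \<le> n" for n
  proof -
    have p: "0 < q powi (2 * n)" by (rule powi_pos)
    then have "gn n \<le> q powi n / 1"
      unfolding gn_def by (intro divide_left_mono mult_pos_pos less_imp_le[OF powi_pos]) linarith+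
    then show ?thesis using that by (simp add: power_int_def)
  qed
  from this[of n] this[of "- n"] show ?thesis by (cases "0 \<le> n") auto
qed

definition gsum :: real where "gsum = 1 + 2 * q / (1 - q)"

lemma has_sum_q_abs: "((\<lambda>n. q ^ nat \<bar>n\<bar>) has_sum gsum) (UNIV :: int set)"
proof -
  have "((\<lambda>n. q * q ^ n) has_sum (q * (1 / (1 - q)))) UNIV"
    by (intro has_sum_cmult_right sums_nonneg_imp_has_sum geometric_sums) auto
  then have *: "((\<lambda>n. q * q ^ n) has_sum (q / (1 - q))) UNIV" by simp
  have "((\<lambda>n. q ^ nat \<bar>n\<bar>) has_sum (q ^ nat \<bar>0\<bar> + q / (1 - q) + q / (1 - q))) (UNIV :: int set)"
    by (rule has_sum_int_iff_nat) (use * in \<open>simp_all add: nat_add_distrib\<close>)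
  moreover have "q ^ nat \<bar>0\<bar> + q / (1 - q) + q / (1 - q) = gsum" by (simp add: gsum_def)
  ultimately show ?thesis by (simp only:)
qed

lemma summable_q_abs: "(\<lambda>n. q ^ nat \<bar>n\<bar>) summable_on (UNIV :: int set)"
  using has_sum_q_abs unfolding summable_on_def by blast

lemma summable_theta: "theta summable_on UNIV"
  by (rule summable_on_real_le[OF summable_q_abs]) (use theta_le theta_pos in \<open>simp add: less_imp_le\<close>)

lemma summable_gn: "gn summable_on UNIV"
  by (rule summable_on_real_le[OF summable_q_abs]) (use gn_le gn_pos in \<open>simp add: less_imp_le\<close>)

lemma summable_sg_theta: "(\<lambda>n. sg n * theta n) summable_on UNIV"
  by (rule summable_on_real_le[OF summable_theta]) (use theta_pos in \<open>simp add: abs_mult less_imp_le\<close>)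

lemma summable_sg_gn: "(\<lambda>n. sg n * gn n) summable_on UNIV"
  by (rule summable_on_real_le[OF summable_gn]) (use gn_pos in \<open>simp add: abs_mult less_imp_le\<close>)

lemma theta3_bounds: "1 \<le> theta3" "theta3 \<le> gsum"
proof -
  have "sum theta {0} \<le> theta3"
    unfolding theta3_def by (rule finite_sum_le_infsum[OF summable_theta]) (use theta_pos in \<open>auto intro: less_imp_le\<close>)
  then show "1 \<le> theta3" by simp
  show "theta3 \<le> gsum"
    using infsum_mono[OF summable_theta summable_q_abs theta_le] infsumI[OF has_sum_q_abs] by (simp add: theta3_def)
qed

lemma lambert_plus_ge_1: "1 \<le> lambert_plus"
proof -
  have "sum gn {0} \<le> infsum gn UNIV"
    by (rule finite_sum_le_infsum[OF summable_gn]) (use gn_pos in \<open>auto intro: less_imp_le\<close>)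
  moreover have "gn 0 = 1 / 2" by (simp add: gn_def)
  ultimately show ?thesis by (simp add: lambert_plus_def)
qed

section \<open>Convolution of the alternating Lambert terms with theta\<close>

definition hn :: "int \<Rightarrow> real" where
  "hn k = (\<Sum>\<^sub>\<infinity>l. (sg l * gn l) * theta (k - l))"

text \<open>By \<open>theta_rec\<close> the two terms combine with the factor gn(l)(q^(-2l) + 1) =
  q^(-l). What remains is (-1)^l q^((l - k)^2 - l) up to a constant; the exponent is invariant under
  l -> 2k + 1 - l while the sign changes.\<close>

lemma hn_rec: "hn (k + 1) = - (q powi (2 * k + 1)) * hn k"
proof -
  have s: "(\<lambda>l. (sg l * gn l) * theta (k - l)) summable_on UNIV" for k
  proof (rule summable_on_real_le[OF summable_gn])
    fix l
    have "theta (k - l) \<le> 1" by (simp add: theta_def power_le_one)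
    then have "gn l * theta (k - l) \<le> gn l * 1"
      using gn_pos by (intro mult_left_mono) (auto intro: less_imp_le)
    then show "\<bar>(sg l * gn l) * theta (k - l)\<bar> \<le> gn l"
      using gn_pos[of l] theta_pos[of "k - l"] by (simp add: abs_mult)
  qed
  have "hn (k + 1) + q powi (2 * k + 1) * hn k
      = (\<Sum>\<^sub>\<infinity>l. (sg l * gn l) * theta (k + 1 - l) + q powi (2 * k + 1) * ((sg l * gn l) * theta (k - l)))"
    unfolding hn_def infsum_cmult_right'[symmetric]
    by (rule infsum_add[symmetric]) (intro s summable_on_cmult_right)+
  also have "\<dots> = (\<Sum>\<^sub>\<infinity>l. q powi (2 * k + 1) * (sg l * (q powi (- l) * theta (l - k))))"
  proof (rule infsum_cong)
    fix l
    define r where "r = q powi l"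
    have r: "0 < r" by (simp add: r_def)
    have "q powi (2 * (k - l) + 1) * (r * r) = q powi (2 * k + 1)"
      unfolding r_def qp_add[symmetric] by (simp add: algebra_simps)
    then have e: "q powi (2 * (k - l) + 1) = q powi (2 * k + 1) * inverse (r * r)"
      using r by (simp add: field_simps)
    have "theta (k + 1 - l) = q powi (2 * (k - l) + 1) * theta (k - l)"
      using theta_rec[of "k - l"] by (simp add: add_diff_eq diff_add_eq)
    note th = this[unfolded e]
    have "theta (- (k - l)) = theta (k - l)" by (rule theta_minus)
    then have g3: "theta (l - k) = theta (k - l)" by simp
    have g2: "q powi (- l) = inverse r"
      unfolding r_def by (rule power_int_minus)
    have g1: "gn l = r / (1 + r * r)"
      unfolding gn_def r_def qp_add[symmetric] by simp
    from recip_plus_inverse_square(1)[OF r]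
    have "gn l * (inverse (r * r) + 1) = q powi (- l)" by (simp only: g1 g2)
    moreover have "(s * g) * (A * I * T) + A * ((s * g) * T) = A * (s * ((g * (I + 1)) * T))"
      for s g A I T :: real by (simp add: algebra_simps)
    ultimately show "(sg l * gn l) * theta (k + 1 - l) + q powi (2 * k + 1) * ((sg l * gn l) * theta (k - l))
        = q powi (2 * k + 1) * (sg l * (q powi (- l) * theta (l - k)))"
      unfolding th g3 by (simp only:)
  qed
  also have "\<dots> = 0"
  proof (rule infsum_int_antisym[where k = "2 * k + 1"])
    fix l
    have "theta (l - k) = q powi (2 * (l - k - 1) + 1) * theta (l - k - 1)"
      using theta_rec[of "l - k - 1"] by simp
    moreover have "theta (2 * k + 1 - l - k) = theta (l - k - 1)"
      using theta_minus[of "l - k - 1"] by (simp add: algebra_simps del: theta_minus)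
    moreover have "q powi (- (2 * k + 1 - l)) = q powi (- l) * q powi (2 * (l - k - 1) + 1)"
      unfolding qp_add[symmetric] by (simp add: algebra_simps)
    ultimately have "q powi (- (2 * k + 1 - l)) * theta (2 * k + 1 - l - k) = q powi (- l) * theta (l - k)"
      by (simp only: mult.assoc)
    then show "q powi (2 * k + 1) * (sg (2 * k + 1 - l) * (q powi (- (2 * k + 1 - l)) * theta (2 * k + 1 - l - k)))
       = - (q powi (2 * k + 1) * (sg l * (q powi (- l) * theta (l - k))))"
      unfolding sg_diff sg_add by (simp only: sg_simps)
  qed
  finally show ?thesis by simp
qed

lemma hn_eq: "hn k = sg k * theta k * hn 0"
  by (rule theta_quasi) (rule hn_rec)

text \<open>The sum of \<open>hn\<close> over k is computed as a convolution and by
  \<open>hn_eq\<close>. Weighting by (-1)^k gives the companion relation; together they eliminate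
  the unknown \<open>hn 0\<close>.\<close>

lemma lambert_minus_theta3: "lambert_minus * theta3 = 2 * theta4 * hn 0"
proof -
  have "(\<Sum>\<^sub>\<infinity>k. hn k) = (lambert_minus / 2) * theta3"
    unfolding hn_def using infsum_int_convolution[OF summable_sg_gn summable_theta] by (simp add: lambert_minus_def theta3_def)
  moreover have "(\<Sum>\<^sub>\<infinity>k. hn k) = theta4 * hn 0"
    unfolding theta4_def infsum_cmult_left'[symmetric] by (rule infsum_cong) (rule hn_eq)
  ultimately show ?thesis by simp
qed

lemma lambert_plus_theta4: "lambert_plus * theta4 = 2 * theta3 * hn 0"
proof -
  have "(\<Sum>\<^sub>\<infinity>k. sg k * hn k) = (\<Sum>\<^sub>\<infinity>k. \<Sum>\<^sub>\<infinity>l. gn l * (sg (k - l) * theta (k - l)))"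
    unfolding hn_def infsum_cmult_right'[symmetric] by (simp add: mult_ac)
  also have "\<dots> = (lambert_plus / 2) * theta4"
    using infsum_int_convolution[OF summable_gn summable_sg_theta] by (simp add: lambert_plus_def theta4_def)
  finally have "(\<Sum>\<^sub>\<infinity>k. sg k * hn k) = (lambert_plus / 2) * theta4" .
  moreover have "(\<Sum>\<^sub>\<infinity>k. sg k * hn k) = theta3 * hn 0"
    unfolding theta3_def infsum_cmult_left'[symmetric] by (rule infsum_cong) (subst hn_eq, simp add: mult_ac)
  ultimately show ?thesis by simp
qed

lemma lambert_plus_lambert_minus_ratio: "lambert_plus * theta4\<^sup>2 = lambert_minus * theta3\<^sup>2"
  by (simp only: power2_eq_square mult.assoc[symmetric] lambert_plus_theta4 lambert_minus_theta3) (simp only: mult_ac)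

section \<open>Passage from q to q^2\<close>

lemma theta_square: "nome.theta (q\<^sup>2) u * nome.theta (q\<^sup>2) v = theta (u + v) * theta (u - v)"
proof -
  have "2 * nat (u * u) + 2 * nat (v * v) = nat ((u + v) * (u + v)) + nat ((u - v) * (u - v))"
    unfolding of_nat_eq_iff[symmetric, where 'a = int]
    by (simp only: of_nat_add of_nat_mult int_nat_eq zero_le_square if_True of_nat_numeral) (simp add: algebra_simps)
  then show ?thesis
    unfolding nome.theta_def[OF nome_square] theta_def power_mult[symmetric] power_add[symmetric] by simp
qed

text \<open>The weights 1 + sg(x + y) and sg x + sg y both vanish on pairs of opposite parity. On x
  = u + v, y = u - v they become 2 and 2 sg(u) sg(v).\<close>

lemma theta3_theta4_square:
  shows "theta3\<^sup>2 + theta4\<^sup>2 = 2 * (nome.theta3 (q\<^sup>2))\<^sup>2"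
    and "theta3 * theta4 = (nome.theta4 (q\<^sup>2))\<^sup>2"
proof -
  interpret sq: nome "q\<^sup>2" by (rule nome_square)
  note s3 = summable_theta and s4 = summable_sg_theta
  let ?U = "UNIV \<times> UNIV :: (int \<times> int) set"
  note [simp] = case_prod_beta'
  have "theta3\<^sup>2 + theta4\<^sup>2 = infsum (\<lambda>(x, y). theta x * theta y) ?U + infsum (\<lambda>(x, y). (sg x * theta x) * (sg y * theta y)) ?U"
    unfolding infsum_real_Times[OF s3 s3] infsum_real_Times[OF s4 s4] by (simp add: theta3_def theta4_def power2_eq_square)
  also have "\<dots> = (\<Sum>\<^sub>\<infinity>p\<in>?U. (1 + sg (fst p + snd p)) * (theta (fst p) * theta (snd p)))"
    using summable_on_real_Times[OF s3 s3] summable_on_real_Times[OF s4 s4]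
    by (subst infsum_add[symmetric]) (auto simp: algebra_simps intro!: infsum_cong)
  also have "\<dots> = infsum (\<lambda>(u, v). 2 * (sq.theta u * sq.theta v)) ?U"
    by (subst infsum_int_pairs_same_parity) (auto simp: sg_def theta_square intro!: infsum_cong)
  also have "\<dots> = 2 * sq.theta3\<^sup>2"
    using infsum_real_Times[OF sq.summable_theta sq.summable_theta]
    by (simp add: infsum_cmult_right' sq.theta3_def power2_eq_square[of "infsum sq.theta UNIV"])
  finally show "theta3\<^sup>2 + theta4\<^sup>2 = 2 * sq.theta3\<^sup>2" .
  have "2 * (theta3 * theta4) = infsum (\<lambda>(x, y). theta x * (sg y * theta y)) ?U + infsum (\<lambda>(x, y). (sg x * theta x) * theta y) ?U"
    unfolding infsum_real_Times[OF s3 s4] infsum_real_Times[OF s4 s3] by (simp add: theta3_def theta4_def)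
  also have "\<dots> = (\<Sum>\<^sub>\<infinity>p\<in>?U. (sg (fst p) + sg (snd p)) * (theta (fst p) * theta (snd p)))"
    using summable_on_real_Times[OF s3 s4] summable_on_real_Times[OF s4 s3]
    by (subst infsum_add[symmetric]) (auto simp: algebra_simps intro!: infsum_cong)
  also have "\<dots> = infsum (\<lambda>(u, v). 2 * ((sg u * sq.theta u) * (sg v * sq.theta v))) ?U"
  proof (subst infsum_int_pairs_same_parity, goal_cases)
    case (1 x y)
    then show ?case by (auto simp: sg_def)
  next
    case 2
    have e: "2 * ((sg u * sq.theta u) * (sg v * sq.theta v)) = (sg (u + v) + sg (u - v)) * (theta (u + v) * theta (u - v))" for u v
      unfolding theta_square[symmetric] by (simp add: algebra_simps)
    show ?case by (simp only: e fst_conv snd_conv)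
  qed
  also have "\<dots> = 2 * sq.theta4\<^sup>2"
    using infsum_real_Times[OF sq.summable_sg_theta sq.summable_sg_theta]
    by (simp add: infsum_cmult_right' sq.theta4_def power2_eq_square[of "\<Sum>\<^sub>\<infinity>n. sg n * sq.theta n"])
  finally show "theta3 * theta4 = sq.theta4\<^sup>2" by simp
qed

lemma lambert_plus_add_lambert_minus: "lambert_plus + lambert_minus = 2 * nome.lambert_plus (q\<^sup>2)"
proof -
  interpret sq: nome "q\<^sup>2" by (rule nome_square)
  have g: "gn (2 * m) = sq.gn m" for m
    unfolding gn_def sq.gn_def by (simp add: power_int_mult)
  have "lambert_plus + lambert_minus = 2 * (\<Sum>\<^sub>\<infinity>l. (1 + sg l) * gn l)"
    using infsum_add[OF summable_gn summable_sg_gn] by (simp add: lambert_plus_def lambert_minus_def distrib_right)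
  also have "(\<Sum>\<^sub>\<infinity>l. (1 + sg l) * gn l) = (\<Sum>\<^sub>\<infinity>m. 2 * sq.gn m) + 0"
  proof (intro infsumI has_sum_int_even_odd)
    show "((\<lambda>n. (1 + sg (2 * n)) * gn (2 * n)) has_sum (\<Sum>\<^sub>\<infinity>m. 2 * sq.gn m)) UNIV"
      using summable_on_cmult_right[OF sq.summable_gn, of 2] by (simp add: g)
    show "((\<lambda>n. (1 + sg (2 * n + 1)) * gn (2 * n + 1)) has_sum 0) UNIV"
      by simp
  qed
  finally show ?thesis by (simp add: sq.lambert_plus_def infsum_cmult_right')
qed

text \<open>Bounding gn(0) = 1/2 by q^0 = 1 would give a bound tending to 2 as q -> 0. The
  correction at 0 makes it tend to 1, the value needed in the limit.\<close>

lemma lambert_plus_le: "lambert_plus \<le> 2 * gsum - 1"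
proof -
  have h: "((\<lambda>n. q ^ nat \<bar>n\<bar> + (if n = 0 then - (1 / 2) else 0)) has_sum (gsum + - (1 / 2))) (UNIV :: int set)"
  proof -
    have "((\<lambda>n. if n = 0 then - (1 / 2) else 0) has_sum (- (1 / 2) :: real)) (UNIV :: int set)"
      by (rule has_sum_finite_neutralI[where B = "{0}"]) auto
    from has_sum_add[OF has_sum_q_abs this] show ?thesis .
  qed
  have "infsum gn UNIV \<le> gsum + - (1 / 2)"
  proof (rule has_sum_mono[OF has_sum_infsum[OF summable_gn] h])
    fix n
    show "gn n \<le> q ^ nat \<bar>n\<bar> + (if n = 0 then - (1 / 2) else 0)"
      using gn_le[of n] by (auto simp: gn_def)
  qed
  then show ?thesis by (simp add: lambert_plus_def)
qed

text \<open>The quotients lambert_plus / theta3^2 and lambert_minus / theta4^2 are equal by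
  \<open>lambert_plus_lambert_minus_ratio\<close>, hence also equal to the quotient of the sums,
  which is the quotient at q^2.\<close>

lemma ratio_square: "nome.lambert_plus (q\<^sup>2) / (nome.theta3 (q\<^sup>2))\<^sup>2 = lambert_plus / theta3\<^sup>2"
proof -
  interpret sq: nome "q\<^sup>2" by (rule nome_square)
  have "0 < sq.theta3" "0 < theta3" using sq.theta3_bounds theta3_bounds by linarith+
  moreover have "2 * sq.lambert_plus * theta3\<^sup>2 = lambert_plus * (2 * sq.theta3\<^sup>2)"
    unfolding lambert_plus_add_lambert_minus[symmetric] theta3_theta4_square(1)[symmetric] distrib_right distrib_left lambert_plus_lambert_minus_ratio ..
  ultimately show ?thesis by (simp add: field_simps)
qed

text \<open>\<open>lambert_plus / theta3^2\<close> is unchanged under \<open>q \<mapsto> q^2\<close> and tends to \<open>1\<close> as \<open>q\<close> tends to \<open>0\<close>.\<close>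

lemma lambert_plus_eq: "lambert_plus = theta3\<^sup>2"
proof -
  define x where "x n = q ^ (2 ^ n)" for n :: nat
  have x: "nome (x n)" for n
    using q_pos q_lt_1 by unfold_locales (auto simp: x_def power_less_one_iff)
  have x_Suc: "x (Suc n) = (x n)\<^sup>2" for n
    by (simp add: x_def power_mult[symmetric] mult.commute)
  have const: "nome.lambert_plus (x n) / (nome.theta3 (x n))\<^sup>2 = lambert_plus / theta3\<^sup>2" for n
  proof (induction n)
    case (Suc n)
    then show ?case unfolding x_Suc nome.ratio_square[OF x] by simp
  qed (simp add: x_def)
  have "x \<longlonglongrightarrow> 0"
  proof (rule tendsto_sandwich[where f = "\<lambda>_. 0" and h = "\<lambda>n. q ^ n"])
    show "\<forall>\<^sub>F n in sequentially. x n \<le> q ^ n"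
      by (intro always_eventually allI) (auto simp: x_def intro!: power_decreasing less_imp_le[OF less_exp])
  qed (auto simp: x_def intro!: LIMSEQ_power_zero)
  then have G: "(\<lambda>n. 1 + 2 * x n / (1 - x n)) \<longlonglongrightarrow> 1 + 2 * 0 / (1 - 0)"
    by (intro tendsto_intros) auto
  have gs: "nome.gsum (x n) = 1 + 2 * x n / (1 - x n)" for n
    by (rule nome.gsum_def[OF x])
  have G1: "(\<lambda>n. nome.gsum (x n)) \<longlonglongrightarrow> 1"
    using G unfolding gs by simp
  have "lambert_plus / theta3\<^sup>2 \<le> 2 * nome.gsum (x n) - 1" for n
  proof -
    interpret xn: nome "x n" by (rule x)
    have "1 \<le> xn.theta3\<^sup>2" using xn.theta3_bounds by simp
    then have "xn.lambert_plus / xn.theta3\<^sup>2 \<le> xn.lambert_plus / 1"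
      using xn.lambert_plus_ge_1 by (intro divide_left_mono) auto
    then show ?thesis using xn.lambert_plus_le const[of n] by simp
  qed
  moreover have "(\<lambda>n. 2 * nome.gsum (x n) - 1) \<longlonglongrightarrow> 2 * 1 - 1"
    by (intro tendsto_intros G1)
  ultimately have le: "lambert_plus / theta3\<^sup>2 \<le> 1"
    by (intro LIMSEQ_le_const) auto
  have "1 / (nome.gsum (x n))\<^sup>2 \<le> lambert_plus / theta3\<^sup>2" for n
  proof -
    interpret xn: nome "x n" by (rule x)
    have "1 / xn.gsum\<^sup>2 \<le> xn.lambert_plus / xn.theta3\<^sup>2"
      using xn.theta3_bounds xn.lambert_plus_ge_1 by (intro frac_le power_mono) auto
    then show ?thesis using const[of n] by simp
  qed
  moreover have "(\<lambda>n. 1 / (nome.gsum (x n))\<^sup>2) \<longlonglongrightarrow> 1 / 1\<^sup>2"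
    by (intro tendsto_intros G1) simp
  ultimately have "1 \<le> lambert_plus / theta3\<^sup>2"
    by (intro LIMSEQ_le_const2[where X = "\<lambda>n. 1 / (nome.gsum (x n))\<^sup>2"]) auto
  with le have "lambert_plus / theta3\<^sup>2 = 1" by linarith
  then show ?thesis using theta3_bounds by (simp add: field_simps split: if_splits)
qed

lemma lambert_minus_eq: "lambert_minus = theta4\<^sup>2"
  using lambert_plus_lambert_minus_ratio theta3_bounds unfolding lambert_plus_eq by (simp add: mult.commute)

subsection \<open>The cube of the theta series\<close>

text \<open>The coefficients \<open>cn\<close> and \<open>dn\<close> do not tend to \<open>0\<close> in both directions, so the sum of
  \<open>(-1)^m pn (2 m)\<close> cannot be factored directly. Their differences with step 2 decay in both directions,
  and passing to them only multiplies the sum by 4.\<close>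

definition dD :: "int \<Rightarrow> real" where "dD n = dn n - dn (n - 2)"
definition cD :: "int \<Rightarrow> real" where "cD n = cn n - cn (n - 2)"

lemma summable_dD: "dD summable_on UNIV"
proof (rule decay_summable)
  show "pos_decay dD"
    using pos_decay_add[OF pos_decay_dn pos_decay_uminus[OF pos_decay_shift[OF pos_decay_dn, of "-2"]]]
    by (rule back_subst[of pos_decay]) (auto simp: dD_def fun_eq_iff)
  have "dD (- n) = dn (n + 2) + - dn n" for n
    using dn_minus[of n] dn_minus[of "n + 2"] by (simp add: dD_def)
  then show "neg_decay dD"
    unfolding neg_decay_def
    using pos_decay_add[OF pos_decay_shift[OF pos_decay_dn, of 2] pos_decay_uminus[OF pos_decay_dn]]
    by simp
qed

lemma summable_cD: "cD summable_on UNIV"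
proof (rule decay_summable)
  have c: "pos_decay (\<lambda>n. cn (- n))"
    using neg_decay_cn by (simp add: neg_decay_def)
  have "cD (- n) = cn (- n) + - cn (- (n + 2))" for n
    by (simp add: cD_def)
  then show "neg_decay cD"
    unfolding neg_decay_def
    using pos_decay_add[OF c pos_decay_uminus[OF pos_decay_shift[OF c, of 2]]] by simp
  have "cD = (\<lambda>n. cn (- (n + -2)) + - cn (- n))"
    using cn_minus[of _] cn_minus[of "_ - 2"] by (simp add: cD_def fun_eq_iff)
  then show "pos_decay cD"
    using pos_decay_add[OF pos_decay_shift[OF c, of "-2"] pos_decay_uminus[OF c]] by (simp only:)
qed

lemma infsum_pn_even: "(\<Sum>\<^sub>\<infinity>m. sg m * pn (2 * m + 2 * k)) = sg k * theta3 * pn 0"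
  and summable_pn_even: "(\<lambda>m. sg m * pn (2 * m + 2 * k)) summable_on UNIV"
proof -
  have e: "sg m * pn (2 * m + 2 * k) = (sg k * pn 0) * theta (m + k)" for m
    unfolding distrib_left[symmetric] pn_even[of "m + k"] by (simp add: mult_ac)
  show "(\<Sum>\<^sub>\<infinity>m. sg m * pn (2 * m + 2 * k)) = sg k * theta3 * pn 0"
    unfolding e infsum_cmult_right' infsum_int_shift[of theta] theta3_def by simp
  show "(\<lambda>m. sg m * pn (2 * m + 2 * k)) summable_on UNIV"
    unfolding e using summable_theta by (intro summable_on_cmult_right) (simp add: summable_on_int_shift)
qed

text \<open>Shifting the summation index shows that the correlation of \<open>cn\<close> and
  \<open>dn\<close> depends only on the difference of the shifts, so a second difference of
  \<open>pn\<close> puts one difference on each factor.\<close>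

lemma pn_second_difference:
  "2 * pn k - pn (k - 2) - pn (k + 2) = (\<Sum>\<^sub>\<infinity>n. cD (n + k) * dD n)"
proof -
  define P where "P i j = (\<Sum>\<^sub>\<infinity>n. cn (n + i) * dn (n + j))" for i j
  have shift: "P i j = pn (i - j)" for i j
    unfolding P_def pn_def using infsum_int_shift[of "\<lambda>n. cn (n + (i - j)) * dn n" j]
    by (simp add: algebra_simps)
  have "(\<Sum>\<^sub>\<infinity>n. cD (n + k) * dD n)
     = (\<Sum>\<^sub>\<infinity>n. (cn (n + k) * dn (n + 0) - cn (n + (k - 2)) * dn (n + 0))
             - (cn (n + k) * dn (n + -2) - cn (n + (k - 2)) * dn (n + -2)))"
    by (intro infsum_cong) (simp add: cD_def dD_def algebra_simps)
  also have "\<dots> = (P k 0 - P (k - 2) 0) - (P k (-2) - P (k - 2) (-2))"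
    unfolding P_def by (simp only: infsum_diff_real summable_on_diff_real summable_pn)
  also have "\<dots> = 2 * pn k - pn (k - 2) - pn (k + 2)"
    unfolding shift by simp
  finally show ?thesis ..
qed

lemma cD_dD_summable: "(\<lambda>(m, n). sg m * (cD (n + 2 * m) * dD n)) summable_on UNIV \<times> UNIV"
proof -
  let ?h = "\<lambda>(m, n). (n + 2 * m, n) :: int \<times> int"
  have a: "(\<lambda>n. \<bar>cD n\<bar>) summable_on UNIV" "(\<lambda>n. \<bar>dD n\<bar>) summable_on UNIV"
    using summable_cD summable_dD summable_on_iff_abs_summable_on_real[of cD] summable_on_iff_abs_summable_on_real[of dD]
    by auto
  have "inj ?h" by (auto simp: inj_on_def)
  moreover have "(\<lambda>(m, n). \<bar>cD m\<bar> * \<bar>dD n\<bar>) summable_on range ?h"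
    by (rule summable_on_subset_banach[OF summable_on_real_Times[OF a]]) auto
  ultimately have "((\<lambda>(m, n). \<bar>cD m\<bar> * \<bar>dD n\<bar>) \<circ> ?h) summable_on UNIV"
    by (simp only: summable_on_reindex)
  then have "((\<lambda>(m, n). \<bar>cD m\<bar> * \<bar>dD n\<bar>) \<circ> ?h) summable_on UNIV \<times> UNIV" by simp
  then show ?thesis
    by (rule summable_on_real_le) (auto simp: abs_mult)
qed

text \<open>The factor 4 is 2 + 1 + 1, since shifting m by one flips the sign in
  \<open>infsum_pn_even\<close>. After swapping the sums, the inner one depends on n only through
  its parity and a sign, so the double sum splits into an even and an odd product.\<close>

lemma four_theta3_pn:
  "4 * theta3 * pn 0 = (\<Sum>\<^sub>\<infinity>j. sg j * (cn (2 * j + 1) - cn (2 * j - 1))) * (\<Sum>\<^sub>\<infinity>j. sg j * (dn (2 * j + 1) - dn (2 * j - 1)))"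
proof -
  define Ec where "Ec = (\<Sum>\<^sub>\<infinity>j. sg j * cD (2 * j))"
  define Oc where "Oc = (\<Sum>\<^sub>\<infinity>j. sg j * cD (2 * j + 1))"
  have "4 * theta3 * pn 0 = 2 * (\<Sum>\<^sub>\<infinity>m. sg m * pn (2 * m + 2 * 0)) - (\<Sum>\<^sub>\<infinity>m. sg m * pn (2 * m + 2 * -1)) - (\<Sum>\<^sub>\<infinity>m. sg m * pn (2 * m + 2 * 1))"
    unfolding infsum_pn_even by (simp add: sg_def)
  also have "\<dots> = (\<Sum>\<^sub>\<infinity>m. 2 * (sg m * pn (2 * m + 2 * 0)) - sg m * pn (2 * m + 2 * -1) - sg m * pn (2 * m + 2 * 1))"
    by (simp only: infsum_diff_real summable_on_diff_real summable_pn_even summable_on_cmult_right infsum_cmult_right')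
  also have "\<dots> = (\<Sum>\<^sub>\<infinity>m. sg m * (2 * pn (2 * m) - pn (2 * m - 2) - pn (2 * m + 2)))"
    by (intro infsum_cong) (simp add: algebra_simps)
  also have "\<dots> = (\<Sum>\<^sub>\<infinity>m. \<Sum>\<^sub>\<infinity>n. sg m * (cD (n + 2 * m) * dD n))"
    unfolding pn_second_difference infsum_cmult_right'[symmetric] ..
  also have "\<dots> = (\<Sum>\<^sub>\<infinity>n. \<Sum>\<^sub>\<infinity>m. sg m * (cD (n + 2 * m) * dD n))"
    by (rule infsum_swap_banach[OF cD_dD_summable])
  also have "\<dots> = (\<Sum>\<^sub>\<infinity>n. dD n * (\<Sum>\<^sub>\<infinity>m. sg m * cD (n + 2 * m)))"
    unfolding infsum_cmult_right'[symmetric] by (simp add: mult_ac)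
  also have "\<dots> = (\<Sum>\<^sub>\<infinity>j. (sg j * dD (2 * j)) * Ec) + (\<Sum>\<^sub>\<infinity>j. (sg j * dD (2 * j + 1)) * Oc)"
  proof (intro infsumI has_sum_int_even_odd)
    have 1: "(\<Sum>\<^sub>\<infinity>m. sg m * cD (2 * j + 2 * m)) = sg j * Ec" for j
      using infsum_int_shift[of "\<lambda>m. (sg j * sg m) * cD (2 * m)" j]
      unfolding Ec_def infsum_cmult_right'[symmetric] by (simp add: algebra_simps)
    have 2: "(\<Sum>\<^sub>\<infinity>m. sg m * cD (2 * j + 1 + 2 * m)) = sg j * Oc" for j
      using infsum_int_shift[of "\<lambda>m. (sg j * sg m) * cD (2 * m + 1)" j]
      unfolding Oc_def infsum_cmult_right'[symmetric] by (simp add: algebra_simps)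
    have s: "(\<lambda>j. (sg j * dD (2 * j + k)) * C) summable_on UNIV" for C k
    proof (rule summable_on_cmult_left, rule summable_on_real_le)
      show "(\<lambda>j. \<bar>dD (2 * j + k)\<bar>) summable_on UNIV"
        using summable_on_int_affine[OF summable_dD, of 2 k] summable_on_iff_abs_summable_on_real[of "\<lambda>j. dD (2 * j + k)"] by simp
    qed (simp add: abs_mult)
    show "((\<lambda>j. dD (2 * j) * (\<Sum>\<^sub>\<infinity>m. sg m * cD (2 * j + 2 * m))) has_sum (\<Sum>\<^sub>\<infinity>j. (sg j * dD (2 * j)) * Ec)) UNIV"
      unfolding 1 using has_sum_infsum[OF s[of 0 Ec]] by (simp add: mult_ac)
    show "((\<lambda>j. dD (2 * j + 1) * (\<Sum>\<^sub>\<infinity>m. sg m * cD (2 * j + 1 + 2 * m))) has_sum (\<Sum>\<^sub>\<infinity>j. (sg j * dD (2 * j + 1)) * Oc)) UNIV"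
      unfolding 2 using has_sum_infsum[OF s[of 1 Oc]] by (simp add: mult_ac)
  qed
  \<comment> \<open>\<open>dD\<close> is symmetric about 1 because dn(-n) = 1 - dn(n); the
    reflection j -> 1 - j then flips the alternating sign. Only the odd product survives.\<close>
  also have "(\<Sum>\<^sub>\<infinity>j. (sg j * dD (2 * j)) * Ec) = 0"
  proof (rule infsum_int_antisym[where k = 1])
    fix j
    have "dD (2 * (1 - j)) = dD (2 * j)"
      using dn_minus[of "2 * j"] dn_minus[of "2 * j - 2"] by (simp add: dD_def algebra_simps)
    then show "sg (1 - j) * dD (2 * (1 - j)) * Ec = - (sg j * dD (2 * j) * Ec)"
      by (simp only: sg_diff sg_simps)
  qed
  finally show ?thesis
    by (simp add: infsum_cmult_left' Oc_def dD_def cD_def mult.commute)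
qed

section \<open>Lambert series for the two alternating sums\<close>

definition tau :: real where
  "tau = infsum (\<lambda>(l, i). (-1) ^ (l + i) * q ^ (Suc l * (2 * i + 1))) (UNIV \<times> UNIV)"

lemma summable_q_pow: "(\<lambda>n. q ^ n) summable_on (UNIV :: nat set)"
  by (rule summable_on_geometric) auto

lemma summable_tau: "(\<lambda>(l, i). (-1) ^ (l + i) * q ^ (Suc l * (2 * i + 1))) summable_on UNIV \<times> UNIV"
proof (rule summable_on_real_le[OF summable_on_real_Times[OF summable_q_pow summable_q_pow]])
  fix p :: "nat \<times> nat"
  obtain l i where p: "p = (l, i)" by (cases p)
  have "q ^ (Suc l * (2 * i + 1)) \<le> q ^ (l + i)"
    by (rule power_decreasing) (auto simp: algebra_simps)
  then show "\<bar>case p of (l, i) \<Rightarrow> (-1) ^ (l + i) * q ^ (Suc l * (2 * i + 1))\<bar> \<le> (case p of (x, y) \<Rightarrow> q ^ x * q ^ y)"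
    unfolding p by (simp add: abs_mult power_abs power_add)
qed

lemma lambert_minus_tau: "lambert_minus = 1 - 4 * tau"
proof -
  have g: "(\<Sum>\<^sub>\<infinity>i. (-1) ^ (l + i) * q ^ (Suc l * (2 * i + 1))) = (-1) ^ l * gn (int (Suc l))" for l
  proof -
    define r where "r = q ^ Suc l"
    have "0 \<le> r" "r < 1"
      using power_Suc_less_one[of q l] by (simp_all add: r_def)
    then have r: "0 \<le> r * r" "r * r < 1"
      using mult_right_mono[of r 1 r] by auto
    have e: "(-1) ^ (l + i) * q ^ (Suc l * (2 * i + 1)) = ((-1) ^ l * r) * ((-1) ^ i * (r * r) ^ i)" for i
      unfolding r_def power_add power_mult by (simp add: power_mult power2_eq_square power_mult_distrib mult_ac)
    have "gn (int (Suc l)) = r / (1 + r * r)"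
    proof -
      have "q powi (2 * int (Suc l)) = r * r" "q powi int (Suc l) = r"
        using power_int_of_nat[of q "2 * Suc l"] power_int_of_nat[of q "Suc l"]
        unfolding r_def power_mult[symmetric] power_add[symmetric] by (simp_all only: of_nat_mult of_nat_add of_nat_numeral mult_2)
      then show ?thesis unfolding gn_def by (simp only:)
    qed
    then show ?thesis
      unfolding e infsum_cmult_right' infsum_alternating_geometric(1)[OF r] by simp
  qed
  have t: "(\<Sum>\<^sub>\<infinity>l. (-1) ^ l * gn (int (Suc l))) = tau"
    unfolding tau_def g[symmetric] using infsum_Sigma'_banach[OF summable_tau] by simp
  have "(\<lambda>l. (-1) ^ l * gn (int (Suc l))) summable_on UNIV"
    unfolding g[symmetric] using summable_on_Sigma_banach[OF summable_tau] by simp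
  then have "((\<lambda>l. - ((-1) ^ l * gn (int (Suc l)))) has_sum (- tau)) UNIV"
    unfolding has_sum_uminus t[symmetric] by simp
  then have "((\<lambda>l. sg l * gn l) has_sum (sg 0 * gn 0 + - tau + - tau)) UNIV"
    by (intro has_sum_int_iff_nat; unfold sg_simps gn_minus sg_int) simp_all
  then show ?thesis by (simp add: lambert_minus_def infsumI gn_def)
qed

text \<open>The double series \<open>tau\<close> summed in the other order: geometric series in i
  give \<open>gn\<close>, as in \<open>lambert_minus_tau\<close>, while geometric series in l give
  \<open>dn\<close> at odd arguments.\<close>

lemma dn_tau: "(\<Sum>\<^sub>\<infinity>j. (-1) ^ j * dn (2 * int j + 1)) = tau"
  and summable_dn_odd: "(\<lambda>j. dn (2 * int j + 1)) summable_on UNIV"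
proof -
  have d: "(\<Sum>\<^sub>\<infinity>l. (-1) ^ (l + j) * q ^ (Suc l * (2 * j + 1))) = (-1) ^ j * dn (2 * int j + 1)" for j
  proof -
    define r where "r = q ^ (2 * j + 1)"
    have r: "0 \<le> r" "r < 1"
      using power_Suc_less_one[of q "2 * j"] q_pos q_lt_1 by (auto simp: r_def)
    have e: "(-1) ^ (l + j) * q ^ (Suc l * (2 * j + 1)) = ((-1) ^ j * r) * ((-1) ^ l * r ^ l)" for l
      unfolding r_def mult.commute[of "Suc l"] power_mult by (simp add: power_add mult_ac)
    have "q powi (2 * int j + 1) = r"
      using power_int_of_nat[of q "2 * j + 1"] unfolding r_def by (simp only: of_nat_mult of_nat_add of_nat_numeral of_nat_1)
    then have "dn (2 * int j + 1) = r / (1 + r)" unfolding dn_def by (simp only:)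
    then show ?thesis
      unfolding e infsum_cmult_right' infsum_alternating_geometric(1)[OF r] by simp
  qed
  have "(\<Sum>\<^sub>\<infinity>j. (-1) ^ j * dn (2 * int j + 1)) = (\<Sum>\<^sub>\<infinity>l. \<Sum>\<^sub>\<infinity>j. (-1) ^ (l + j) * q ^ (Suc l * (2 * j + 1)))"
    unfolding d[symmetric] by (rule infsum_swap_banach[OF summable_tau, symmetric])
  then show "(\<Sum>\<^sub>\<infinity>j. (-1) ^ j * dn (2 * int j + 1)) = tau"
    unfolding tau_def using infsum_Sigma'_banach[OF summable_tau] by simp
  show "(\<lambda>j. dn (2 * int j + 1)) summable_on UNIV"
  proof (rule summable_on_real_le[OF summable_q_pow])
    fix j
    have "dn (2 * int j + 1) \<le> q ^ (2 * j + 1)"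
      using dn_le[of "2 * int j + 1"] power_int_of_nat[of q "2 * j + 1"] by (simp only: of_nat_mult of_nat_add of_nat_numeral of_nat_1)
    also have "\<dots> \<le> q ^ j" by (rule power_decreasing) auto
    finally show "\<bar>dn (2 * int j + 1)\<bar> \<le> q ^ j" using dn_pos[of "2 * int j + 1"] by simp
  qed
qed

text \<open>Of r and 2n + 1 - r exactly one is even, so r -> 2n + 1 - r matches the two halves of
  the sum. Writing the even factor as 2(l + 1) turns q into q^2.\<close>

lemma inner_sum_odd:
  "inner_sum (2 * n + 1) = 2 * (\<Sum>l<n. (q\<^sup>2) ^ (Suc l * (2 * (n - 1 - l) + 1)))"
proof -
  have "inner_sum (2 * n + 1) = (\<Sum>r<2 * n. q ^ (Suc r * (2 * n + 1 - Suc r)))"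
    unfolding inner_sum_def using sum.shift_bounds_Suc_ivl[of "\<lambda>r. q ^ (r * (2 * n + 1 - r))" 0 "2 * n"]
    by (simp add: atLeast0LessThan)
  also have "\<dots> = (\<Sum>l<n. q ^ (Suc (2 * l) * (2 * n + 1 - Suc (2 * l)))) + (\<Sum>l<n. q ^ (Suc (2 * l + 1) * (2 * n + 1 - Suc (2 * l + 1))))"
    by (rule sum_lessThan_double)
  also have "(\<Sum>l<n. q ^ (Suc (2 * l + 1) * (2 * n + 1 - Suc (2 * l + 1)))) = (\<Sum>l<n. (q\<^sup>2) ^ (Suc l * (2 * (n - 1 - l) + 1)))"
  proof (rule sum.cong[OF refl])
    fix l assume "l \<in> {..<n}"
    then have "2 * n + 1 - Suc (2 * l + 1) = 2 * (n - 1 - l) + 1" "Suc (2 * l + 1) = 2 * Suc l" by auto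
    then show "q ^ (Suc (2 * l + 1) * (2 * n + 1 - Suc (2 * l + 1))) = (q\<^sup>2) ^ (Suc l * (2 * (n - 1 - l) + 1))"
      by (simp only: power_mult[symmetric] mult.assoc)
  qed
  also have "(\<Sum>l<n. q ^ (Suc (2 * l) * (2 * n + 1 - Suc (2 * l)))) = (\<Sum>l<n. (q\<^sup>2) ^ (Suc l * (2 * (n - 1 - l) + 1)))"
  proof (rule sum.reindex_bij_witness[where i = "\<lambda>l. n - 1 - l" and j = "\<lambda>l. n - 1 - l"])
    fix l assume "l \<in> {..<n}"
    then have "2 * n + 1 - Suc (2 * l) = 2 * Suc (n - 1 - l)" "n - 1 - (n - 1 - l) = l" by auto
    then show "(q\<^sup>2) ^ (Suc (n - 1 - l) * (2 * (n - 1 - (n - 1 - l)) + 1)) = q ^ (Suc (2 * l) * (2 * n + 1 - Suc (2 * l)))"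
      by (simp only: power_mult[symmetric] mult.assoc) (simp only: Suc_eq_plus1 mult_ac)
  qed auto
  finally show ?thesis by simp
qed

text \<open>The antidiagonal l + i = k of the series \<open>tau\<close> at q^2 corresponds to n = k
  + 1; this shift produces the minus sign.\<close>

lemma inner_sum_tau: "(\<Sum>\<^sub>\<infinity>n. (-1) ^ n * inner_sum (2 * n + 1)) = - 2 * nome.tau (q\<^sup>2)"
  and summable_inner_sum_odd: "(\<lambda>n. inner_sum (2 * n + 1)) summable_on UNIV"
proof -
  interpret sq: nome "q\<^sup>2" by (rule nome_square)
  define f where "f l i = (-1) ^ (l + i) * (q\<^sup>2) ^ (Suc l * (2 * i + 1))" for l i
  have sf: "(\<lambda>(l, i). f l i) summable_on UNIV \<times> UNIV"
    unfolding f_def by (rule sq.summable_tau)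
  have e: "(-1) ^ Suc k * inner_sum (2 * Suc k + 1) = -2 * (\<Sum>l\<le>k. f l (k - l))" for k
  proof -
    have "(\<Sum>l\<le>k. f l (k - l)) = (\<Sum>l\<le>k. (-1) ^ k * (q\<^sup>2) ^ (Suc l * (2 * (k - l) + 1)))"
      unfolding f_def by (rule sum.cong) auto
    then show ?thesis
      unfolding inner_sum_odd by (simp add: lessThan_Suc_atMost sum_distrib_left[symmetric])
  qed
  have "((\<lambda>k. -2 * (\<Sum>l\<le>k. f l (k - l))) has_sum (-2 * sq.tau)) UNIV"
    using infsum_triangle[OF sf] unfolding sq.tau_def f_def[symmetric]
    by (intro has_sum_cmult_right) (simp only: has_sum_iff)
  moreover have "inner_sum (2 * 0 + 1) = 0" by (simp add: inner_sum_def)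
  ultimately have h: "((\<lambda>n. (-1) ^ n * inner_sum (2 * n + 1)) has_sum (-2 * sq.tau)) UNIV"
    using has_sum_nat_Suc[of "\<lambda>n. (-1) ^ n * inner_sum (2 * n + 1)" "-2 * sq.tau"] unfolding e by simp
  then show "(\<Sum>\<^sub>\<infinity>n. (-1) ^ n * inner_sum (2 * n + 1)) = - 2 * nome.tau (q\<^sup>2)"
    by (rule infsumI)
  from h have "(\<lambda>n. (-1) ^ n * inner_sum (2 * n + 1)) summable_on UNIV"
    by (rule has_sum_imp_summable)
  then show "(\<lambda>n. inner_sum (2 * n + 1)) summable_on UNIV"
    using summable_on_iff_abs_summable_on_real[of "\<lambda>n. (-1) ^ n * inner_sum (2 * n + 1)"]
    by (simp add: abs_mult power_abs inner_sum_nonneg)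
qed

text \<open>At odd arguments \<open>dn\<close> has K = 1, L = 0 and \<open>cn\<close> has K = L = -2
  in \<open>infsum_int_alternating_odd\<close>. The two factors of \<open>four_theta3_pn\<close>
  thus become -lambert_minus(q) and -2 lambert_minus(q^2), that is, -theta4^2 and -2 theta3
  theta4.\<close>

theorem theta4_cubed: "theta4 ^ 3 = 2 * pn 0"
proof -
  interpret sq: nome "q\<^sup>2" by (rule nome_square)
  have c: "cn (2 * int n + 1) - (-2) = - inner_sum (2 * n + 1)" for n
  proof -
    have "nat (2 * int n + 1) = 2 * n + 1" by simp
    then show ?thesis by (simp add: cn_def)
  qed
  have "(\<Sum>\<^sub>\<infinity>j. sg j * (dn (2 * j + 1) - dn (2 * j - 1))) = 2 * 0 - 1 + 4 * (\<Sum>\<^sub>\<infinity>n. (-1) ^ n * (dn (2 * int n + 1) - 0))"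
    by (rule infsum_int_alternating_odd) (use dn_minus summable_dn_odd in simp_all)
  then have 1: "(\<Sum>\<^sub>\<infinity>j. sg j * (dn (2 * j + 1) - dn (2 * j - 1))) = - lambert_minus"
    using dn_tau lambert_minus_tau by simp
  have "(\<Sum>\<^sub>\<infinity>j. sg j * (cn (2 * j + 1) - cn (2 * j - 1))) = 2 * (-2) - (-2) + 4 * (\<Sum>\<^sub>\<infinity>n. (-1) ^ n * (cn (2 * int n + 1) - (-2)))"
  proof (rule infsum_int_alternating_odd)
    show "(\<lambda>n. cn (2 * int n + 1) - (-2)) summable_on UNIV"
      unfolding c using summable_inner_sum_odd by (simp only: summable_on_uminus)
  qed (simp add: cn_minus sg_def)
  also have "\<dots> = -2 - 4 * (\<Sum>\<^sub>\<infinity>n. (-1) ^ n * inner_sum (2 * n + 1))"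
    unfolding c by (simp add: infsum_uminus)
  also have "\<dots> = - 2 * sq.lambert_minus"
    unfolding inner_sum_tau sq.lambert_minus_tau by simp
  finally have "4 * theta3 * pn 0 = (- 2 * sq.lambert_minus) * (- lambert_minus)"
    using four_theta3_pn unfolding 1 by simp
  also have "\<dots> = 2 * (theta3 * theta4) * theta4\<^sup>2"
    unfolding sq.lambert_minus_eq lambert_minus_eq theta3_theta4_square(2) by simp
  finally have "theta3 * (4 * pn 0) = theta3 * (2 * theta4 ^ 3)"
    by (simp add: power2_eq_square power3_eq_cube mult_ac)
  then show ?thesis using theta3_bounds by simp
qed

section \<open>Expansion of the scalar into pair and triple sums\<close>

definition pair_sum :: real where
  "pair_sum = infsum (\<lambda>(r, s). (-1) ^ (r + s) * q ^ (Suc r * Suc s)) (UNIV \<times> UNIV)"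

text \<open>All indices are shifted down by one from the positive integers. Three shifts reverse the
  sign, so the identity has +4 here; the two shifts in \<open>pair_sum\<close> leave the sign
  unchanged.\<close>

definition triple_sum :: real where
  "triple_sum = infsum (\<lambda>((r, s), t). (-1) ^ (r + s + t) * q ^ (Suc r * Suc s + (Suc r + Suc s) * Suc t)) ((UNIV \<times> UNIV) \<times> UNIV)"

lemma summable_pair_sum: "(\<lambda>(r, s). (-1) ^ (r + s) * q ^ (Suc r * Suc s)) summable_on UNIV \<times> UNIV"
proof (rule summable_on_real_le[OF summable_on_real_Times[OF summable_q_pow summable_q_pow]], goal_cases)
  case (1 p)
  obtain r s where p: "p = (r, s)" by (cases p)
  have "q ^ (Suc r * Suc s) \<le> q ^ (r + s)"
    by (rule power_decreasing) auto
  then show ?case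
    unfolding p by (simp add: abs_mult power_abs power_add)
qed

lemma summable_triple_sum:
  "(\<lambda>((r, s), t). (-1) ^ (r + s + t) * q ^ (Suc r * Suc s + (Suc r + Suc s) * Suc t)) summable_on (UNIV \<times> UNIV) \<times> UNIV"
proof (rule summable_on_real_le[OF summable_on_real_Times[OF summable_on_real_Times[OF summable_q_pow summable_q_pow] summable_q_pow]], goal_cases)
  case (1 p)
  obtain r s t where p: "p = ((r, s), t)" by (metis surj_pair)
  have "q ^ (Suc r * Suc s + (Suc r + Suc s) * Suc t) \<le> q ^ (r + s + t)"
    by (rule power_decreasing) auto
  then show ?case
    unfolding p by (simp add: abs_mult power_abs power_add)
qed

lemma dn_series: "(\<Sum>\<^sub>\<infinity>t. (-1) ^ t * q ^ (Suc n * Suc t)) = dn (int (Suc n))"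
proof -
  define r where "r = q ^ Suc n"
  have r: "0 \<le> r" "r < 1"
    using power_Suc_less_one[of q n] by (simp_all add: r_def)
  have e: "(-1) ^ t * q ^ (Suc n * Suc t) = r * ((-1) ^ t * r ^ t)" for t
    unfolding r_def power_mult by simp
  have "q powi int (Suc n) = r"
    unfolding r_def by (rule power_int_of_nat)
  then have "dn (int (Suc n)) = r / (1 + r)" unfolding dn_def by (simp only:)
  then show ?thesis
    unfolding e infsum_cmult_right' infsum_alternating_geometric(1)[OF r] by simp
qed

lemma inner_sum_Suc: "inner_sum (Suc (Suc k)) = (\<Sum>r\<le>k. q ^ (Suc r * Suc (k - r)))"
proof -
  have "inner_sum (Suc (Suc k)) = (\<Sum>r<Suc k. q ^ (Suc r * (Suc (Suc k) - Suc r)))"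
    unfolding inner_sum_def using sum.shift_bounds_Suc_ivl[of "\<lambda>r. q ^ (r * (Suc (Suc k) - r))" 0 "Suc k"]
    by (simp only: atLeast0LessThan One_nat_def)
  also have "\<dots> = (\<Sum>r\<le>k. q ^ (Suc r * Suc (k - r)))"
    unfolding lessThan_Suc_atMost by (rule sum.cong) (auto simp: Suc_diff_le)
  finally show ?thesis .
qed

text \<open>For n \<ge> 1 the terms for n and -n together give (-1)^n (2 d + 2 I d - I), where d =
  dn(n) and I = inner_sum(n). Expanding d as a geometric series makes these 2u, 2v and w, which sum
  to -2 and 2 and 1 times the pair, triple and pair sums respectively; w enters with a minus sign,
  and n = 0 gives 1/2.\<close>

lemma pn_0_series: "2 * pn 0 = 1 - 6 * pair_sum + 4 * triple_sum"
proof -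
  define u where "u n = (-1) ^ Suc n * dn (int (Suc n))" for n
  define w where "w n = (-1) ^ Suc n * inner_sum (Suc n)" for n
  define v where "v n = w n * dn (int (Suc n))" for n
  have "(\<Sum>\<^sub>\<infinity>t. - ((-1) ^ (n + t) * q ^ (Suc n * Suc t))) = u n" for n
    unfolding u_def dn_series[symmetric] infsum_uminus infsum_cmult_right'[symmetric]
    by (simp add: power_add mult.assoc infsum_uminus)
  then have u': "u = (\<lambda>n. - (\<Sum>\<^sub>\<infinity>t. (-1) ^ (n + t) * q ^ (Suc n * Suc t)))"
    by (simp add: infsum_uminus fun_eq_iff)
  have u: "(u has_sum (- pair_sum)) UNIV"
    unfolding u' has_sum_uminus pair_sum_def
    using summable_on_Sigma_banach[OF summable_pair_sum] infsum_Sigma'_banach[OF summable_pair_sum]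
    by (simp only: has_sum_iff minus_minus)
  define f where "f r s = (-1) ^ (r + s) * q ^ (Suc r * Suc s)" for r s
  have sf: "(\<lambda>(r, s). f r s) summable_on UNIV \<times> UNIV"
    unfolding f_def by (rule summable_pair_sum)
  have wS: "w (Suc k) = (\<Sum>r\<le>k. f r (k - r))" for k
    unfolding w_def inner_sum_Suc f_def sum_distrib_left by (rule sum.cong) auto
  have w0: "w 0 = 0" by (simp add: w_def inner_sum_def)
  have "((\<lambda>k. w (Suc k)) has_sum pair_sum) UNIV"
    unfolding wS using infsum_triangle[OF sf] by (simp only: has_sum_iff pair_sum_def f_def)
  then have w: "(w has_sum pair_sum) UNIV"
    using has_sum_nat_Suc[of w] w0 by simp
  define F where "F r s = f r s * dn (int (Suc (Suc (r + s))))" for r s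
  have F: "F r s = (\<Sum>\<^sub>\<infinity>t. case ((r, s), t) of ((r, s), t) \<Rightarrow> (-1) ^ (r + s + t) * q ^ (Suc r * Suc s + (Suc r + Suc s) * Suc t))" for r s
    unfolding F_def f_def dn_series[symmetric] infsum_cmult_right'[symmetric]
    by (rule infsum_cong) (simp add: power_add algebra_simps)
  have Fp: "(\<lambda>(r, s). F r s) = (\<lambda>p. \<Sum>\<^sub>\<infinity>t. case (p, t) of ((r, s), t) \<Rightarrow> (-1) ^ (r + s + t) * q ^ (Suc r * Suc s + (Suc r + Suc s) * Suc t))"
    by (auto simp: F fun_eq_iff)
  have s3: "(\<lambda>(p, t). case (p, t) of ((r, s), t) \<Rightarrow> (-1) ^ (r + s + t) * q ^ (Suc r * Suc s + (Suc r + Suc s) * Suc t)) summable_on (UNIV \<times> UNIV) \<times> UNIV"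
    using summable_triple_sum by (simp add: case_prod_beta')
  have sF: "(\<lambda>(r, s). F r s) summable_on UNIV \<times> UNIV"
    unfolding Fp by (rule summable_on_Sigma_banach[OF s3])
  have iF: "infsum (\<lambda>(r, s). F r s) (UNIV \<times> UNIV) = triple_sum"
    unfolding Fp infsum_Sigma'_banach[OF s3] triple_sum_def by (simp add: case_prod_beta')
  have "v (Suc k) = (\<Sum>r\<le>k. F r (k - r))" for k
    unfolding v_def wS F_def sum_distrib_right by (rule sum.cong) auto
  then have "((\<lambda>k. v (Suc k)) has_sum triple_sum) UNIV"
    using infsum_triangle[OF sF] iF by (simp only: has_sum_iff)
  then have v: "(v has_sum triple_sum) UNIV"
    using has_sum_nat_Suc[of v] w0 by (simp add: v_def)
  define h where "h n = cn n * dn n" for n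
  have sh: "h summable_on UNIV"
    using summable_pn[of 0 0] by (simp add: h_def[abs_def])
  have pn: "infsum h UNIV = pn 0"
    by (simp add: pn_def h_def[abs_def])
  have s1: "(\<lambda>n. h (int (Suc n))) summable_on UNIV"
    using summable_on_subset_banach[OF sh subset_UNIV, of "range (\<lambda>n. int (Suc n))"]
    by (subst (asm) summable_on_reindex) (simp_all add: o_def inj_on_def)
  have s2: "(\<lambda>n. h (- int (Suc n))) summable_on UNIV"
    using summable_on_subset_banach[OF sh subset_UNIV, of "range (\<lambda>n. - int (Suc n))"]
    by (subst (asm) summable_on_reindex) (simp_all add: o_def inj_on_def)
  have "pn 0 = h 0 + (\<Sum>\<^sub>\<infinity>n. h (int (Suc n))) + (\<Sum>\<^sub>\<infinity>n. h (- int (Suc n)))"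
    unfolding pn[symmetric] by (intro infsumI has_sum_int_iff_nat has_sum_infsum s1 s2)
  also have "\<dots> = h 0 + (\<Sum>\<^sub>\<infinity>n. h (int (Suc n)) + h (- int (Suc n)))"
    by (simp only: infsum_add[OF s1 s2] add.assoc)
  also have "(\<lambda>n. h (int (Suc n)) + h (- int (Suc n))) = (\<lambda>n. 2 * u n + 2 * v n - w n)"
  proof
    fix n
    have "cn (int (Suc n)) = (-1) ^ Suc n * (2 + inner_sum (Suc n))"
      unfolding cn_def sg_int nat_int by simp
    moreover have "cn (- int (Suc n)) = - ((-1) ^ Suc n * inner_sum (Suc n))"
      unfolding cn_def sg_simps sg_int minus_minus nat_int by simp
    ultimately show "h (int (Suc n)) + h (- int (Suc n)) = 2 * u n + 2 * v n - w n"
      unfolding h_def dn_minus u_def v_def w_def by (simp only:) (simp add: algebra_simps)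
  qed
  also have "infsum \<dots> UNIV = 2 * (- pair_sum) + 2 * triple_sum - pair_sum"
    by (rule infsumI) (intro has_sum_add has_sum_diff_real has_sum_cmult_right u v w)
  finally show ?thesis by (simp add: h_def cn_def dn_def)
qed

end

subsection \<open>Sums of three squares\<close>

lemma has_sum_group_by_exponent:
  fixes c :: "'i \<Rightarrow> real" and e :: "'i \<Rightarrow> nat"
  assumes s: "((\<lambda>i. c i * q ^ e i) has_sum S) A" and fin: "\<And>n. finite {i \<in> A. e i = n}"
  shows "((\<lambda>n. (\<Sum>i | i \<in> A \<and> e i = n. c i) * q ^ n) has_sum S) UNIV"
proof (rule has_sum_Sigma'[where f = "\<lambda>(n, i). c i * q ^ e i" and A = UNIV and B = "\<lambda>n. {i \<in> A. e i = n}"])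
  have b: "bij_betw snd (Sigma UNIV (\<lambda>n. {i \<in> A. e i = n})) A"
    by (rule bij_betw_byWitness[where f' = "\<lambda>i. (e i, i)"]) auto
  show "((\<lambda>(n, i). c i * q ^ e i) has_sum S) (Sigma UNIV (\<lambda>n. {i \<in> A. e i = n}))"
    using has_sum_reindex_bij_betw[OF b, of "\<lambda>i. c i * q ^ e i"] s by (simp add: case_prod_beta')
  fix n
  have "((\<lambda>i. c i * q ^ e i) has_sum (\<Sum>i | i \<in> A \<and> e i = n. c i * q ^ e i)) {i \<in> A. e i = n}"
    using fin by (intro has_sum_finite)
  moreover have "(\<Sum>i | i \<in> A \<and> e i = n. c i * q ^ e i) = (\<Sum>i | i \<in> A \<and> e i = n. c i) * q ^ n"
    by (simp add: sum_distrib_right)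
  ultimately show "((\<lambda>i. case (n, i) of (n, i) \<Rightarrow> c i * q ^ e i) has_sum (\<Sum>i | i \<in> A \<and> e i = n. c i) * q ^ n) {i \<in> A. e i = n}"
    by simp
qed

text \<open>If all lower coefficients vanish, dividing by q^m leaves a series that is 0 for q > 0
  and tends to c(m) as q -> 0. Vanishing is known only for positive q, hence the one-sided
  limit.\<close>

lemma power_series_zero:
  fixes c :: "nat \<Rightarrow> real"
  assumes "\<And>q. 0 < q \<Longrightarrow> q < 1 \<Longrightarrow> ((\<lambda>n. c n * q ^ n) has_sum 0) UNIV"
  shows "c n = 0"
proof (induction n rule: less_induct)
  case (less m)
  define g where "g x = (\<Sum>n. c (n + m) * x ^ n)" for x :: real
  have z: "(\<lambda>n. c (n + m) * q ^ n) sums 0" if q: "0 < q" "q < 1" for q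
  proof -
    have "(\<lambda>n. c n * q ^ n) sums 0"
      using assms[OF q] by (rule has_sum_imp_sums)
    then have "(\<lambda>n. c (n + m) * q ^ (n + m)) sums (0 - (\<Sum>i<m. c i * q ^ i))"
      by (rule sums_split_initial_segment)
    then have "(\<lambda>n. c (n + m) * q ^ (n + m)) sums 0"
      using less by simp
    then have "(\<lambda>n. inverse (q ^ m) * (c (n + m) * q ^ (n + m))) sums (inverse (q ^ m) * 0)"
      by (rule sums_mult)
    then show ?thesis using q by (simp add: power_add field_simps)
  qed
  have "summable (\<lambda>n. c (n + m) * (1 / 2) ^ n)"
    using z[of "1 / 2"] by (simp add: sums_iff)
  then have "(\<lambda>n. c (n + m) * x ^ n) sums g x" if "norm x < 1 / 2" for x
    unfolding g_def by (rule summable_sums[OF powser_inside]) (use that in simp)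
  from powser_limit_0[OF _ this, of "1 / 2"] have "(g \<longlongrightarrow> c (0 + m)) (at 0)"
    by simp
  then have "(g \<longlongrightarrow> c m) (at_right 0)"
    by (intro filterlim_at_split[THEN iffD1, THEN conjunct2]) simp
  moreover have "\<forall>\<^sub>F x in at_right 0. g x = 0"
    unfolding eventually_at_right[OF zero_less_one]
    by (intro exI[of _ 1]) (auto simp: g_def sums_iff dest: z)
  ultimately have "((\<lambda>x :: real. 0 :: real) \<longlongrightarrow> c m) (at_right 0)"
    by (rule Lim_transform_eventually)
  then show ?case by (simp add: tendsto_const_iff)
qed

definition positive_pairs :: "nat \<Rightarrow> (nat \<times> nat) set" where
  "positive_pairs n = {(r, s). Suc r * Suc s = n}"

definition positive_triples :: "nat \<Rightarrow> ((nat \<times> nat) \<times> nat) set" where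
  "positive_triples n = {((r, s), t). Suc r * Suc s + (Suc r + Suc s) * Suc t = n}"

definition square_triples :: "nat \<Rightarrow> ((int \<times> int) \<times> int) set" where
  "square_triples n = {((x, y), z). nat (x * x) + nat (y * y) + nat (z * z) = n}"

lemma finite_positive_pairs: "finite (positive_pairs n)"
proof (rule finite_subset)
  show "positive_pairs n \<subseteq> {..n} \<times> {..n}" unfolding positive_pairs_def by auto
qed simp

lemma finite_positive_triples: "finite (positive_triples n)"
proof (rule finite_subset)
  show "positive_triples n \<subseteq> ({..n} \<times> {..n}) \<times> {..n}" unfolding positive_triples_def by auto
qed simp

lemma abs_le_square: "\<bar>x\<bar> \<le> x * x" for x :: int
  using mult_right_mono[of 1 "\<bar>x\<bar>" "\<bar>x\<bar>"] by (cases "x = 0") auto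

lemma finite_square_triples: "finite (square_triples n)"
proof (rule finite_subset)
  have "x \<in> {- int n..int n}" if "nat (x * x) \<le> n" for x :: int
    using that abs_le_square[of x] by auto
  then show "square_triples n \<subseteq> ({- int n..int n} \<times> {- int n..int n}) \<times> {- int n..int n}"
    unfolding square_triples_def by fastforce
qed simp

context nome
begin

lemma has_sum_pairs: "((\<lambda>n. (\<Sum>(r, s)\<in>positive_pairs n. (-1) ^ (r + s)) * q ^ n) has_sum pair_sum) UNIV"
proof -
  have "((\<lambda>i. (case i of (r, s) \<Rightarrow> (-1) ^ (r + s)) * q ^ (case i of (r, s) \<Rightarrow> Suc r * Suc s)) has_sum pair_sum) (UNIV \<times> UNIV)"
    using has_sum_infsum[OF summable_pair_sum] unfolding pair_sum_def by (simp only: case_prod_beta')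
  from has_sum_group_by_exponent[OF this] finite_positive_pairs
  show ?thesis by (simp add: positive_pairs_def case_prod_beta')
qed

lemma has_sum_triples: "((\<lambda>n. (\<Sum>((r, s), t)\<in>positive_triples n. (-1) ^ (r + s + t)) * q ^ n) has_sum triple_sum) UNIV"
proof -
  have "((\<lambda>i. (case i of ((r, s), t) \<Rightarrow> (-1) ^ (r + s + t)) * q ^ (case i of ((r, s), t) \<Rightarrow> Suc r * Suc s + (Suc r + Suc s) * Suc t)) has_sum triple_sum) ((UNIV \<times> UNIV) \<times> UNIV)"
    using has_sum_infsum[OF summable_triple_sum] unfolding triple_sum_def by (simp only: case_prod_beta')
  from has_sum_group_by_exponent[OF this] finite_positive_triples
  show ?thesis by (simp add: positive_triples_def case_prod_beta')
qed

lemma has_sum_squares: "((\<lambda>n. (\<Sum>((x, y), z)\<in>square_triples n. sg (x + y + z)) * q ^ n) has_sum theta4 ^ 3) UNIV"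
proof -
  note s = summable_sg_theta
  have "((\<lambda>(p, z). (case p of (x, y) \<Rightarrow> (sg x * theta x) * (sg y * theta y)) * (sg z * theta z)) has_sum theta4 ^ 3) ((UNIV \<times> UNIV) \<times> UNIV)"
    unfolding has_sum_iff using summable_on_real_Times[OF summable_on_real_Times[OF s s] s]
      infsum_real_Times[OF summable_on_real_Times[OF s s] s] infsum_real_Times[OF s s]
    by (simp only: theta4_def power3_eq_cube)
  then have "((\<lambda>i. (case i of ((x, y), z) \<Rightarrow> sg (x + y + z)) * q ^ (case i of ((x, y), z) \<Rightarrow> nat (x * x) + nat (y * y) + nat (z * z))) has_sum theta4 ^ 3) ((UNIV \<times> UNIV) \<times> UNIV)"
    by (rule back_subst[of "\<lambda>f. (f has_sum _) _"]) (simp add: fun_eq_iff theta_def power_add mult_ac)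
  from has_sum_group_by_exponent[OF this] finite_square_triples
  show ?thesis by (simp add: square_triples_def case_prod_beta')
qed

end

lemma signed_three_squares_count:
  "(\<Sum>((x, y), z)\<in>square_triples n. sg (x + y + z)) = (if n = 0 then 1 else 0)
     - 6 * (\<Sum>(r, s)\<in>positive_pairs n. (-1) ^ (r + s))
     + 4 * (\<Sum>((r, s), t)\<in>positive_triples n. (-1) ^ (r + s + t))"
proof -
  define R P T where "R n = (\<Sum>((x, y), z)\<in>square_triples n. sg (x + y + z))"
    and "P n = (\<Sum>(r, s)\<in>positive_pairs n. (-1) ^ (r + s) :: real)"
    and "T n = (\<Sum>((r, s), t)\<in>positive_triples n. (-1) ^ (r + s + t) :: real)" for n
  define c where "c n = R n - (if n = 0 then 1 else 0) + 6 * P n - 4 * T n" for n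
  have "c n = 0"
  proof (rule power_series_zero)
    fix q :: real assume "0 < q" "q < 1"
    then interpret nome q by unfold_locales
    have R: "((\<lambda>n. R n * q ^ n) has_sum theta4 ^ 3) UNIV"
      unfolding R_def by (rule has_sum_squares)
    have P: "((\<lambda>n. P n * q ^ n) has_sum pair_sum) UNIV"
      unfolding P_def by (rule has_sum_pairs)
    have T: "((\<lambda>n. T n * q ^ n) has_sum triple_sum) UNIV"
      unfolding T_def by (rule has_sum_triples)
    have O: "((\<lambda>n. (if n = 0 then 1 else 0) * q ^ n) has_sum 1) UNIV"
      by (rule has_sum_finite_neutralI[where B = "{0}"]) auto
    have "((\<lambda>n. R n * q ^ n - (if n = 0 then 1 else 0) * q ^ n + 6 * (P n * q ^ n) - 4 * (T n * q ^ n)) has_sum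
        (theta4 ^ 3 - 1 + 6 * pair_sum - 4 * triple_sum)) UNIV"
      by (intro has_sum_add has_sum_diff_real has_sum_cmult_right R P T O)
    moreover have "theta4 ^ 3 - 1 + 6 * pair_sum - 4 * triple_sum = 0"
      unfolding theta4_cubed pn_0_series by simp
    moreover have "R n * q ^ n - (if n = 0 then 1 else 0) * q ^ n + 6 * (P n * q ^ n) - 4 * (T n * q ^ n) = c n * q ^ n" for n
      unfolding c_def by (simp only: ring_distribs mult.assoc)
    ultimately show "((\<lambda>n. c n * q ^ n) has_sum 0) UNIV" by simp
  qed
  then show ?thesis unfolding c_def R_def P_def T_def by simp
qed

section \<open>Signs of the coefficients and the three-square theorem\<close>

lemma positive_triples_all_odd_mod_8:
  assumes "((r, s), t) \<in> positive_triples n" and "n mod 8 = 3" and "even r" "even s" "even t"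
  shows "s mod 4 = t mod 4"
proof -
  obtain a b c where abc: "r = 2 * a" "s = 2 * b" "t = 2 * c" using assms(3-5) by (auto elim!: evenE)
  define k where "k = a * (b + c) + b * c + a + b + c"
  have n: "n = 4 * k + 3"
    using assms(1) unfolding positive_triples_def abc k_def by (auto simp: algebra_simps)
  have "even k" using assms(2) unfolding n by presburger
  then have "even b = even c" unfolding k_def by (cases "even a"; cases "even b"; cases "even c"; simp)
  then show ?thesis unfolding abc by presburger
qed

lemma signed_triples_le_pairs:
  assumes n: "n mod 8 = 3"
  shows "(\<Sum>((r, s), t)\<in>positive_triples n. (-1) ^ (r + s + t) :: real) \<le> card (positive_pairs n)"
proof -
  define E where "E = {((r, s), t) \<in> positive_triples n. even r \<and> even s \<and> even t}"
  define F where "F = {((r, s), t) \<in> positive_triples n. \<not> (even r \<and> even s \<and> even t)}"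
  \<comment> \<open>With \<open>R = r + 1\<close> etc., an all-odd triple with \<open>S < T\<close> is sent to \<open>(2R + S, S, (T - S)/2)\<close>,
    whose last entry is even because \<open>S\<close> and \<open>T\<close> agree mod 4; the triples with \<open>S = T\<close> inject into the factorizations of \<open>n\<close>.\<close>
  define E1 where "E1 = {((r, s), t) \<in> E. s \<noteq> t}"
  define E2 where "E2 = {((r, s), t) \<in> E. s = t}"
  have fin: "finite E" "finite F" "finite E1" "finite E2"
    unfolding E_def F_def E1_def E2_def by (auto intro: finite_subset[OF _ finite_positive_triples[of n]])
  have U: "positive_triples n = E \<union> F" "E \<inter> F = {}" "E = E1 \<union> E2" "E1 \<inter> E2 = {}"
    unfolding E_def F_def E1_def E2_def by auto
  have odd: "odd (r + s + t)" if "((r, s), t) \<in> F" for r s t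
  proof -
    have "odd n" using n by presburger
    then have "odd (Suc r * Suc s + (Suc r + Suc s) * Suc t)"
      using that by (auto simp: F_def positive_triples_def)
    with that show ?thesis
      unfolding F_def by (cases "even r"; cases "even s"; cases "even t"; simp)
  qed
  have "(\<Sum>((r, s), t)\<in>positive_triples n. (-1) ^ (r + s + t) :: real)
      = (\<Sum>((r, s), t)\<in>E. (-1) ^ (r + s + t)) + (\<Sum>((r, s), t)\<in>F. (-1) ^ (r + s + t))"
    unfolding U(1) by (rule sum.union_disjoint) (use fin U in auto)
  also have "(\<Sum>((r, s), t)\<in>E. (-1) ^ (r + s + t) :: real) = (\<Sum>p\<in>E. 1)"
    by (rule sum.cong) (auto simp: E_def)
  also have "(\<Sum>((r, s), t)\<in>F. (-1) ^ (r + s + t) :: real) = (\<Sum>p\<in>F. -1)"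
  proof (rule sum.cong[OF refl], clarify)
    fix r s t assume "((r, s), t) \<in> F"
    from odd[OF this] show "(-1) ^ (r + s + t) = (-1 :: real)" by (rule neg_one_odd_power)
  qed
  finally have "(\<Sum>((r, s), t)\<in>positive_triples n. (-1) ^ (r + s + t) :: real) = real (card E) - real (card F)"
    by simp
  moreover have "card E = card E1 + card E2"
    unfolding U(3) by (rule card_Un_disjoint) (use fin U in auto)
  moreover have "card E1 \<le> card F"
  proof -
    \<comment> \<open>RS + RT + ST = (R + S)(S + T) - S^2. The map keeps S, doubles R + S and halves
      S + T, so n is preserved. For S > T the roles of S and T are exchanged and the kept entry is
      put first; the order of the first two entries therefore tells the two branches apart, which
      gives injectivity.\<close>
    define g :: "(nat \<times> nat) \<times> nat \<Rightarrow> (nat \<times> nat) \<times> nat" where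
      "g = (\<lambda>((r, s), t). if s < t then ((2 * r + s + 2, s), (t - s) div 2 - 1) else ((t, 2 * r + t + 2), (s - t) div 2 - 1))"
    have diff: "\<exists>k. (s < t \<and> t = s + 4 * Suc k) \<or> (t < s \<and> s = t + 4 * Suc k)" if "((r, s), t) \<in> E1" for r s t
    proof -
      have m: "s mod 4 = t mod 4" "s \<noteq> t"
        using positive_triples_all_odd_mod_8[of r s t n] that n by (auto simp: E1_def E_def)
      have *: "\<exists>k. y = x + 4 * Suc k" if "x < y" "x mod 4 = y mod 4" for x y :: nat
      proof -
        have "4 dvd y - x" using that mod_eq_dvd_iff_nat[of x y 4] by simp
        then obtain j where j: "y - x = 4 * j" ..
        with that(1) have "y = x + 4 * Suc (j - 1)" by (cases j) auto
        then show ?thesis ..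
      qed
      show ?thesis using *[of s t] *[of t s] m by (cases "s < t") auto
    qed
    have "g p \<in> F" if "p \<in> E1" for p
    proof -
      obtain r s t where p: "p = ((r, s), t)" by (metis surj_pair)
      have m: "Suc r * Suc s + (Suc r + Suc s) * Suc t = n" and ev: "even r" "even s" "even t"
        using that unfolding p E1_def E_def positive_triples_def by auto
      from diff[OF that[unfolded p]] obtain k where
        "(s < t \<and> t = s + 4 * Suc k) \<or> (t < s \<and> s = t + 4 * Suc k)" by blast
      then show ?thesis
      proof
        assume *: "s < t \<and> t = s + 4 * Suc k"
        then have t: "t = s + 4 * Suc k" by simp
        have "g p = ((2 * r + s + 2, s), 2 * k + 1)" unfolding p g_def t by simp
        moreover have "Suc (2 * r + s + 2) * Suc s + (Suc (2 * r + s + 2) + Suc s) * Suc (2 * k + 1) = n"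
          unfolding m[symmetric] t by (simp add: algebra_simps)
        ultimately show ?thesis unfolding F_def positive_triples_def by simp
      next
        assume *: "t < s \<and> s = t + 4 * Suc k"
        then have s: "s = t + 4 * Suc k" by simp
        have "g p = ((t, 2 * r + t + 2), 2 * k + 1)" unfolding p g_def s by simp
        moreover have "Suc t * Suc (2 * r + t + 2) + (Suc t + Suc (2 * r + t + 2)) * Suc (2 * k + 1) = n"
          unfolding m[symmetric] s by (simp add: algebra_simps)
        ultimately show ?thesis unfolding F_def positive_triples_def by simp
      qed
    qed
    moreover have "inj_on g E1"
    proof (rule inj_onI)
      fix p p' assume pE: "p \<in> E1" "p' \<in> E1" and e: "g p = g p'"
      obtain r s t where p: "p = ((r, s), t)" by (metis surj_pair)
      obtain r' s' t' where p': "p' = ((r', s'), t')" by (metis surj_pair)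
      from diff[OF pE(1)[unfolded p]] obtain k where
        "(s < t \<and> t = s + 4 * Suc k) \<or> (t < s \<and> s = t + 4 * Suc k)" by blast
      moreover from diff[OF pE(2)[unfolded p']] obtain k' where
        "(s' < t' \<and> t' = s' + 4 * Suc k') \<or> (t' < s' \<and> s' = t' + 4 * Suc k')" by blast
      ultimately show "p = p'"
        using e unfolding p p' g_def by auto
    qed
    ultimately show ?thesis
      by (intro card_inj_on_le[of g]) (use fin in auto)
  qed
  moreover have "card E2 \<le> card (positive_pairs n)"
  \<comment> \<open>For S = T the form factors: n = S(2R + S).\<close>
  proof (rule card_inj_on_le[where f = "\<lambda>((r, s), t). (s, 2 * r + s + 2)"])
    show "inj_on (\<lambda>((r, s), t). (s, 2 * r + s + 2)) E2"
      by (auto simp: inj_on_def E2_def)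
    show "(\<lambda>((r, s), t). (s, 2 * r + s + 2)) ` E2 \<subseteq> positive_pairs n"
      by (auto simp: E2_def E_def positive_pairs_def positive_triples_def algebra_simps)
  qed (rule finite_positive_pairs)
  ultimately show ?thesis by linarith
qed

theorem three_squares:
  assumes "n mod 4 = 1 \<or> n mod 4 = 2 \<or> n mod 8 = (3 :: nat)"
  shows "\<exists>x y z :: int. int n = x\<^sup>2 + y\<^sup>2 + z\<^sup>2"
proof (rule ccontr)
  assume no: "\<not> ?thesis"
  have n0: "0 < n" using assms by (cases n) auto
  have "square_triples n = {}"
  proof -
    have False if "nat (x * x) + nat (y * y) + nat (z * z) = n" for x y z :: int
    proof -
      have "int n = x\<^sup>2 + y\<^sup>2 + z\<^sup>2" unfolding that[symmetric] by (simp add: power2_eq_square)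
      with no show False by blast
    qed
    then show ?thesis unfolding square_triples_def by auto
  qed
  then have eq: "6 * (\<Sum>(r, s)\<in>positive_pairs n. (-1) ^ (r + s) :: real) = 4 * (\<Sum>((r, s), t)\<in>positive_triples n. (-1) ^ (r + s + t))"
    using signed_three_squares_count[of n] n0 by simp
  have "(0, n - 1) \<in> positive_pairs n" using n0 by (simp add: positive_pairs_def)
  then have pos: "0 < card (positive_pairs n)"
    using finite_positive_pairs by (metis card_gt_0_iff empty_iff)
  consider "n mod 4 = 1" | "n mod 4 = 2" | "n mod 8 = 3" using assms by blast
  then show False
  proof cases
    \<comment> \<open>Write R = r + 1 and so on. Both factors of n are odd, so every pair has sign
      +1. In a triple at least two of R, S, T are odd, and three would force n to be 3 modulo 4;
      exactly two odd means that r + s + t is odd. The left side of \<open>eq\<close> is positive,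
      the right side is not.\<close>
    case 1
    have "odd n" using 1 by presburger
    have "(\<Sum>(r, s)\<in>positive_pairs n. (-1) ^ (r + s) :: real) = (\<Sum>p\<in>positive_pairs n. 1)"
    proof (rule sum.cong[OF refl], clarify)
      fix r s assume "(r, s) \<in> positive_pairs n"
      then have m: "n = Suc r * Suc s" by (simp add: positive_pairs_def)
      have "odd (Suc r * Suc s)" using \<open>odd n\<close> unfolding m .
      then have "even r" "even s" unfolding even_mult_iff by simp_all
      then show "(-1) ^ (r + s) = (1 :: real)" by simp
    qed
    moreover have "(\<Sum>((r, s), t)\<in>positive_triples n. (-1) ^ (r + s + t) :: real) \<le> 0"
    proof (rule sum_nonpos, clarify)
      fix r s t assume "((r, s), t) \<in> positive_triples n"
      then have m: "n = Suc r * Suc s + (Suc r + Suc s) * Suc t" by (simp add: positive_triples_def)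
      have "odd (r + s + t)"
      proof
        assume ev: "even (r + s + t)"
        have "odd (Suc r * Suc s + (Suc r + Suc s) * Suc t)" using \<open>odd n\<close> m by simp
        with ev have "even r" "even s" "even t" by (cases "even r"; cases "even s"; cases "even t"; simp)+
        then obtain a b c where abc: "r = 2 * a" "s = 2 * b" "t = 2 * c" by (auto elim!: evenE)
        have "n = 4 * (a * (b + c) + b * c + a + b + c) + 3" unfolding m abc by (simp add: algebra_simps)
        with 1 show False by presburger
      qed
      then show "(-1) ^ (r + s + t) \<le> (0 :: real)" by (subst neg_one_odd_power) simp_all
    qed
    ultimately show False using eq pos by simp
  next
    \<comment> \<open>Now exactly one factor of n is even, so every pair has sign -1. In a triple at
      most one of R, S, T is odd, and none would force 4 to divide n; exactly one odd means that r +
      s + t is even.\<close>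
    case 2
    have "(\<Sum>(r, s)\<in>positive_pairs n. (-1) ^ (r + s) :: real) = (\<Sum>p\<in>positive_pairs n. -1)"
    proof (rule sum.cong[OF refl], clarify)
      fix r s assume "(r, s) \<in> positive_pairs n"
      then have m: "n = Suc r * Suc s" by (simp add: positive_pairs_def)
      have "odd (r + s)"
      proof
        assume "even (r + s)"
        then consider "even r" "even s" | "odd r" "odd s" by auto
        then show False
        proof cases
          case a: 1
          then have "odd n" unfolding m by simp
          then show False using 2 by presburger
        next
          case b: 2
          then obtain i j where "Suc r = 2 * i" "Suc s = 2 * j" by (metis even_Suc evenE)
          then have "n = 4 * (i * j)" unfolding m by simp
          then show False using 2 by simp
        qed
      qed
      then show "(-1) ^ (r + s) = (-1 :: real)" by (rule neg_one_odd_power)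
    qed
    moreover have "0 \<le> (\<Sum>((r, s), t)\<in>positive_triples n. (-1) ^ (r + s + t) :: real)"
    proof (rule sum_nonneg, clarify)
      fix r s t assume "((r, s), t) \<in> positive_triples n"
      then have m: "n = Suc r * Suc s + (Suc r + Suc s) * Suc t" by (simp add: positive_triples_def)
      have "even (r + s + t)"
      proof (rule ccontr)
        assume od: "odd (r + s + t)"
        have "even n" using 2 by presburger
        then have "even (Suc r * Suc s + (Suc r + Suc s) * Suc t)" using m by simp
        with od have "odd r" "odd s" "odd t" by (cases "even r"; cases "even s"; cases "even t"; simp)+
        then obtain i j k where "Suc r = 2 * i" "Suc s = 2 * j" "Suc t = 2 * k" by (metis even_Suc evenE)
        then have "n = 4 * (i * j + (i + j) * k)" unfolding m by (simp add: algebra_simps)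
        then show False using 2 by simp
      qed
      then show "0 \<le> ((-1) ^ (r + s + t) :: real)" by simp
    qed
    ultimately show False using eq pos by simp
  next
    \<comment> \<open>All pairs have sign +1, and the triple sum is at most the number P of pairs,
      so \<open>eq\<close> would give 6P \<le> 4P with P > 0.\<close>
    case 3
    have "odd n" using 3 by presburger
    have "(\<Sum>(r, s)\<in>positive_pairs n. (-1) ^ (r + s) :: real) = (\<Sum>p\<in>positive_pairs n. 1)"
    proof (rule sum.cong[OF refl], clarify)
      fix r s assume "(r, s) \<in> positive_pairs n"
      then have m: "n = Suc r * Suc s" by (simp add: positive_pairs_def)
      have "odd (Suc r * Suc s)" using \<open>odd n\<close> unfolding m .
      then have "even r" "even s" unfolding even_mult_iff by simp_all
      then show "(-1) ^ (r + s) = (1 :: real)" by simp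
    qed
    then show False using eq pos signed_triples_le_pairs[OF 3] by simp
  qed
qed

subsection \<open>Cauchy's lemma and the choice of the sum\<close>

lemma abs_sum_less_if_squares:
  fixes p q r k :: int
  assumes "3 * (p\<^sup>2 + q\<^sup>2 + r\<^sup>2) < k\<^sup>2" and "0 \<le> k"
  shows "\<bar>p\<bar> + \<bar>q\<bar> + \<bar>r\<bar> < k"
proof (rule power2_less_imp_less[OF _ assms(2)])
  have "(x + y + z)\<^sup>2 \<le> 3 * (x\<^sup>2 + y\<^sup>2 + z\<^sup>2)" for x y z :: int
    using zero_le_power2[of "x - y"] zero_le_power2[of "y - z"] zero_le_power2[of "x - z"]
    by (simp add: power2_eq_square algebra_simps)
  from this[of "\<bar>p\<bar>" "\<bar>q\<bar>" "\<bar>r\<bar>"] assms(1)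
  show "(\<bar>p\<bar> + \<bar>q\<bar> + \<bar>r\<bar>)\<^sup>2 < k\<^sup>2" by simp
qed

lemma square_eq_4:
  obtains k where "(x :: int)\<^sup>2 = 4 * k + (if even x then 0 else 1)"
proof (cases "even x")
  case True
  then obtain k where "x = 2 * k" ..
  then have "x\<^sup>2 = 4 * k\<^sup>2" by simp
  with True that show ?thesis by simp
next
  case False
  then obtain k where "x = 2 * k + 1" ..
  then have "x\<^sup>2 = 4 * (k * k + k) + 1" by (simp add: power2_eq_square algebra_simps)
  with False that[of "k * k + k"] show ?thesis by simp
qed

lemma odd_square_eq_8:
  assumes "odd (x :: int)"
  obtains k where "x\<^sup>2 = 8 * k + 1"
proof -
  obtain k where k: "x = 2 * k + 1" using assms ..
  have "even (k * k + k)" by simp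
  then obtain j where "k * k + k = 2 * j" ..
  moreover have "x\<^sup>2 = 4 * (k * k + k) + 1" unfolding k by (simp add: power2_eq_square algebra_simps)
  ultimately show ?thesis using that by simp
qed

text \<open>4s - t^2 is 3 modulo 8, so it is a sum of three odd squares p^2 + q^2 + r^2. The numbers
  (t + p + q + r)/4, (t + p - q - r)/4, (t - p + q - r)/4, (t - p - q + r)/4 have sum t and square
  sum s. A choice of sign for r makes them integers. The last hypothesis gives |p| + |q| + |r| < t +
  4, so the numerators are multiples of 4 above -4.\<close>

lemma cauchy_lemma_odd:
  fixes s t :: int
  assumes "odd s" "odd t" "0 \<le> t" "t\<^sup>2 < 4 * s" "3 * s < t\<^sup>2 + 2 * t + 4"
  shows "\<exists>w x y z :: nat. s = (int w)\<^sup>2 + (int x)\<^sup>2 + (int y)\<^sup>2 + (int z)\<^sup>2 \<and> t = int w + int x + int y + int z"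
proof -
  define n where "n = nat (4 * s - t\<^sup>2)"
  have n: "int n = 4 * s - t\<^sup>2" unfolding n_def using assms by simp
  obtain i where i: "s = 2 * i + 1" using assms(1) ..
  obtain l where l: "t\<^sup>2 = 8 * l + 1" using odd_square_eq_8[OF assms(2)] .
  have n8: "int n = 8 * (i - l) + 3" using n i l by simp
  have "int (n mod 8) = 3"
    unfolding of_nat_mod of_nat_numeral n8 mod_mult_self4 by simp
  then have "n mod 8 = 3" by simp
  then obtain p q r0 where e0: "int n = p\<^sup>2 + q\<^sup>2 + r0\<^sup>2" using three_squares[of n] by auto
  obtain P Q R where PQR: "p\<^sup>2 = 4 * P + (if even p then 0 else 1)"
    "q\<^sup>2 = 4 * Q + (if even q then 0 else 1)" "r0\<^sup>2 = 4 * R + (if even r0 then 0 else 1)"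
    using square_eq_4[of p] square_eq_4[of q] square_eq_4[of r0] by metis
  have mod4: "c = 3" if "8 * d + 3 = 4 * x + c" "0 \<le> c" "c \<le> 3" for c d x :: int
  proof -
    have "c mod 4 = (4 * x + c) mod 4" by simp
    also have "\<dots> = (4 * (2 * d) + 3) mod 4" unfolding that(1)[symmetric] by simp
    also have "\<dots> = 3" unfolding mod_mult_self4 by simp
    finally show ?thesis using that(2,3) by simp
  qed
  have "(if even p then 0 else 1) + (if even q then 0 else 1) + (if even r0 then 0 else 1) = (3 :: int)"
    by (rule mod4[of "i - l" "P + Q + R"]) (use n8 e0 PQR in simp_all)
  then have odd: "odd p" "odd q" "odd r0"
    by (auto split: if_splits)
  obtain r w where r: "r\<^sup>2 = r0\<^sup>2" "odd r" and w: "t + p + q + r = 4 * w"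
  proof -
    obtain a b c d where abcd: "t = 2 * a + 1" "p = 2 * b + 1" "q = 2 * c + 1" "r0 = 2 * d + 1"
      using assms(2) odd by (elim oddE) blast
    show ?thesis
    proof (cases "even (a + b + c + d)")
      case True
      then obtain f where "a + b + c + d = 2 * f" ..
      then have "t + p + q + r0 = 4 * (f + 1)" using abcd by simp
      with that[of r0] odd show ?thesis by blast
    next
      case False
      then obtain f where "a + b + c + d = 2 * f + 1" ..
      then have "t + p + q + - r0 = 4 * (f + 1 - d)" using abcd by simp
      with that[of "- r0" "f + 1 - d"] odd show ?thesis by simp
    qed
  qed
  have "even (q + r)" "even (p + r)" "even (p + q)" using odd r by auto
  then obtain i j k where ijk: "q + r = 2 * i" "p + r = 2 * j" "p + q = 2 * k" by (elim evenE) blast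
  have "\<bar>p\<bar> + \<bar>q\<bar> + \<bar>r\<bar> < t + 4"
  proof (rule abs_sum_less_if_squares)
    have "3 * (p\<^sup>2 + q\<^sup>2 + r\<^sup>2) = 12 * s - 3 * t\<^sup>2" using e0 n r(1) by simp
    moreover have "(t + 4)\<^sup>2 = t\<^sup>2 + 8 * t + 16" by (simp add: power2_eq_square algebra_simps)
    ultimately show "3 * (p\<^sup>2 + q\<^sup>2 + r\<^sup>2) < (t + 4)\<^sup>2" using assms(5) by linarith
  qed (use assms in simp)
  then have nn: "0 \<le> w" "0 \<le> w - i" "0 \<le> w - j" "0 \<le> w - k"
    using w ijk by linarith+
  have t: "t = w + (w - i) + (w - j) + (w - k)" using w ijk by linarith
  have pqr: "p = j + k - i" "q = i + k - j" "r = i + j - k" using ijk by linarith+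
  have "4 * s = t\<^sup>2 + p\<^sup>2 + q\<^sup>2 + r\<^sup>2" using e0 n r(1) by simp
  also have "\<dots> = 4 * (w\<^sup>2 + (w - i)\<^sup>2 + (w - j)\<^sup>2 + (w - k)\<^sup>2)"
    unfolding pqr t by (simp add: power2_eq_square algebra_simps)
  finally have s: "s = w\<^sup>2 + (w - i)\<^sup>2 + (w - j)\<^sup>2 + (w - k)\<^sup>2" by simp
  show ?thesis
    using s t nn by (intro exI[of _ "nat w"] exI[of _ "nat (w - i)"] exI[of _ "nat (w - j)"] exI[of _ "nat (w - k)"]) simp
qed

text \<open>Here s = 2h and t = 2u, and s - t^2/4 = 2h - u^2 is 1 or 2 modulo 4. The same four
  combinations with u and denominator 2 are integers by parity alone, and their numerators exceed
  -2.\<close>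

lemma cauchy_lemma_even:
  fixes h u :: int
  assumes "odd h" "0 \<le> u" "u\<^sup>2 < 2 * h" "3 * (2 * h) < (2 * u)\<^sup>2 + 2 * (2 * u) + 4"
  shows "\<exists>w x y z :: nat. 2 * h = (int w)\<^sup>2 + (int x)\<^sup>2 + (int y)\<^sup>2 + (int z)\<^sup>2 \<and> 2 * u = int w + int x + int y + int z"
proof -
  define n where "n = nat (2 * h - u\<^sup>2)"
  have n: "int n = 2 * h - u\<^sup>2" unfolding n_def using assms by simp
  obtain i where i: "h = 2 * i + 1" using assms(1) ..
  obtain l where l: "u\<^sup>2 = 4 * l + (if even u then 0 else 1)" using square_eq_4 .
  have n4: "int n = 4 * (i - l) + (if even u then 2 else 1)" using n i l by simp
  have "int (n mod 4) = (if even u then 2 else 1)"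
    unfolding of_nat_mod of_nat_numeral n4 mod_mult_self4 by simp
  then have "n mod 4 = 1 \<or> n mod 4 = 2" by (simp split: if_splits)
  then obtain p q r where e: "int n = p\<^sup>2 + q\<^sup>2 + r\<^sup>2" using three_squares[of n] by blast
  have "u\<^sup>2 + p\<^sup>2 + q\<^sup>2 + r\<^sup>2 = 2 * h" using e n by linarith
  then have "even (u\<^sup>2 + p\<^sup>2 + q\<^sup>2 + r\<^sup>2)" by simp
  then have "even (u + p + q + r)" by simp
  then obtain w where w: "u + p + q + r = 2 * w" ..
  have "\<bar>p\<bar> + \<bar>q\<bar> + \<bar>r\<bar> < u + 2"
  proof (rule abs_sum_less_if_squares)
    have "3 * (p\<^sup>2 + q\<^sup>2 + r\<^sup>2) = 6 * h - 3 * u\<^sup>2" using e n by simp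
    moreover have "(u + 2)\<^sup>2 = u\<^sup>2 + 4 * u + 4" "(2 * u)\<^sup>2 = 4 * u\<^sup>2" by (simp_all add: power2_eq_square algebra_simps)
    ultimately show "3 * (p\<^sup>2 + q\<^sup>2 + r\<^sup>2) < (u + 2)\<^sup>2" using assms(4) by linarith
  qed (use assms in simp)
  then have nn: "0 \<le> w" "0 \<le> w - (q + r)" "0 \<le> w - (p + r)" "0 \<le> w - (p + q)"
    using w by linarith+
  have u: "u = 2 * w - p - q - r" using w by linarith
  have t: "2 * u = w + (w - (q + r)) + (w - (p + r)) + (w - (p + q))" using w by linarith
  have "2 * h = u\<^sup>2 + p\<^sup>2 + q\<^sup>2 + r\<^sup>2" using e n by simp
  also have "\<dots> = w\<^sup>2 + (w - (q + r))\<^sup>2 + (w - (p + r))\<^sup>2 + (w - (p + q))\<^sup>2"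
    unfolding u by (simp add: power2_eq_square algebra_simps)
  finally show ?thesis
    using t nn by (intro exI[of _ "nat w"] exI[of _ "nat (w - (q + r))"] exI[of _ "nat (w - (p + r))"] exI[of _ "nat (w - (p + q))"]) simp
qed

section \<open>Choice of the sum in a residue class\<close>

lemma exists_int_cong_between:
  fixes lo hi :: real and m \<tau> :: int
  assumes "0 < m" and "lo + real_of_int m < hi"
  shows "\<exists>k. lo < real_of_int (\<tau> + m * k) \<and> real_of_int (\<tau> + m * k) < hi"
proof -
  define x where "x = (hi - real_of_int \<tau>) / real_of_int m"
  have m: "0 < real_of_int m" using assms(1) by simp
  have hi: "hi = real_of_int \<tau> + real_of_int m * x" using m by (simp add: x_def)
  define k where "k = \<lceil>x\<rceil> - 1"
  have "real_of_int k < x" "x \<le> real_of_int k + 1" unfolding k_def by linarith+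
  then have "real_of_int m * real_of_int k < real_of_int m * x"
    "real_of_int m * x \<le> real_of_int m * (real_of_int k + 1)" using m by simp_all
  then show ?thesis using assms(2) hi by (intro exI[of _ k]) (simp add: distrib_left)
qed

text \<open>The admissible \<open>t\<close> form the interval between \<open>lo\<close> and \<open>hi\<close>; it is longer than \<open>m\<close> exactly when
  \<open>sqrt (12 A N + D) > 3 L + R\<close>. For \<open>m = 2 a\<close> and \<open>m = 4 a\<close> this is the bound of the theorem for odd and even \<open>n\<close>.\<close>

lemma exists_admissible_sum:
  fixes a b n m \<tau> :: int and R :: real
  defines "A \<equiv> real_of_int a" and "B \<equiv> real_of_int b" and "M \<equiv> real_of_int m"
  defines "L \<equiv> 2 * A * M - 2 * A + B"
  assumes a: "2 \<le> a" and b: "- a < b" and m: "2 * a \<le> m"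
    and R: "0 \<le> R" "R\<^sup>2 = 48 * A * M * (A * M - 2 * A + B)"
    and n: "(3 * L + R)\<^sup>2 < 12 * A * real_of_int n + (9 * B\<^sup>2 + 12 * A * B - 12 * A\<^sup>2)"
  shows "\<exists>k t. t = \<tau> + m * k \<and> 0 < t \<and> a * t\<^sup>2 + 4 * (b * t) < 4 * n \<and> 3 * (n - b * t) < a * t\<^sup>2 + 2 * a * t + 4 * a"
proof -
  define N where "N = real_of_int n"
  \<comment> \<open>Completing squares, the two inequalities become (2AT + 2A + 3B)^2 > 12AN + D and
    (AT + 2B)^2 < 4(B^2 + AN); \<open>Y\<close> and \<open>Z\<close> are the corresponding
    roots.\<close>
  define D where "D = 9 * B\<^sup>2 + 12 * A * B - 12 * A\<^sup>2"
  define Y where "Y = sqrt (12 * A * N + D)"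
  define Z where "Z = sqrt (B\<^sup>2 + A * N)"
  have A: "2 \<le> A" "- A < B" "2 * A \<le> M"
    using a b m by (simp_all add: A_def B_def M_def flip: of_int_mult of_int_minus)
  have AM: "4 * A \<le> A * M" using A mult_mono[of 2 A "2 * A" M] by (simp add: mult.commute)
  have L: "0 < L" using AM A unfolding L_def by linarith
  have n': "(3 * L + R)\<^sup>2 < 12 * A * N + D" using n by (simp add: N_def D_def)
  have "0 \<le> 12 * A * N + D"
    by (rule order_trans[OF zero_le_power2 less_imp_le[OF n']])
  then have Y2: "Y\<^sup>2 = 12 * A * N + D" unfolding Y_def by (rule real_sqrt_pow2)
  have Y: "3 * L + R < Y" unfolding Y_def by (rule real_less_rsqrt) (rule n')
  \<comment> \<open>The length condition is L + Y < 4Z. Squared, with N eliminated through Y^2, it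
    reads (Y - 3L)^2 > 12L^2 + 4D - 48B^2, and the right side equals R^2.\<close>
  have "R\<^sup>2 < (Y - 3 * L)\<^sup>2" using Y R(1) by (intro power_strict_mono) auto
  moreover have "R\<^sup>2 = 12 * L\<^sup>2 + 4 * D - 48 * B\<^sup>2"
    unfolding R(2) L_def D_def by (simp add: power2_eq_square algebra_simps)
  moreover have "16 * (B\<^sup>2 + A * N) = 16 * B\<^sup>2 + 4 * (Y\<^sup>2 - D) / 3" unfolding Y2 by simp
  ultimately have *: "(L + Y)\<^sup>2 < 16 * (B\<^sup>2 + A * N)"
    by (simp add: power2_eq_square algebra_simps)
  have "0 < 16 * (B\<^sup>2 + A * N)" by (rule le_less_trans[OF zero_le_power2 *])
  then have nn: "0 \<le> B\<^sup>2 + A * N" by (simp only: zero_less_mult_iff) auto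
  have Z0: "0 \<le> Z" using nn by (simp add: Z_def)
  have Z2: "Z\<^sup>2 = B\<^sup>2 + A * N" using nn by (simp add: Z_def)
  have "(L + Y)\<^sup>2 < (4 * Z)\<^sup>2" using * unfolding power_mult_distrib Z2 by simp
  then have Z: "L + Y < 4 * Z" using Z0 by (intro power2_less_imp_less[of "L + Y" "4 * Z"]) auto
  define lo where "lo = (Y - 2 * A - 3 * B) / (2 * A)"
  define hi where "hi = (4 * Z - 4 * B) / (2 * A)"
  have A2: "0 < 2 * A" using A by simp
  have "(lo + M) * (2 * A) = Y - 2 * A - 3 * B + 2 * A * M"
    using A2 unfolding lo_def by (simp add: distrib_right)
  also have "\<dots> < 4 * Z - 4 * B" using Z unfolding L_def by linarith
  finally have "lo + M < hi" unfolding hi_def pos_less_divide_eq[OF A2] .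
  then obtain k where k: "lo < real_of_int (\<tau> + m * k)" "real_of_int (\<tau> + m * k) < hi"
    using exists_int_cong_between[of m lo hi \<tau>] a m unfolding M_def by auto
  define t where "t = \<tau> + m * k"
  define T where "T = real_of_int t"
  have lo: "Y < 2 * A * T + 2 * A + 3 * B" and hi: "A * T + 2 * B < 2 * Z"
    using k A unfolding lo_def hi_def t_def[symmetric] T_def[symmetric] by (simp_all add: field_simps)
  have L3: "3 * L = 6 * (A * M) - 6 * A + 3 * B" unfolding L_def by (simp add: algebra_simps)
  have "0 < 2 * (A * T)" using lo[unfolded mult.assoc] Y[unfolded L3] R(1) AM A by linarith
  then have T: "0 < T" using A by (simp add: zero_less_mult_iff)
  have "- (2 * Z) < A * T + 2 * B"
    using Z Y L3 R(1) AM A \<open>0 < 2 * (A * T)\<close> by linarith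
  with hi have "(A * T + 2 * B)\<^sup>2 < (2 * Z)\<^sup>2"
    using power_strict_mono[of "\<bar>A * T + 2 * B\<bar>" "2 * Z" 2] by (simp only: abs_less_iff) simp
  then have "A * (A * T\<^sup>2 + 4 * (B * T)) < A * (4 * N)"
    unfolding power_mult_distrib Z2 by (simp add: power2_eq_square algebra_simps)
  then have 1: "A * T\<^sup>2 + 4 * (B * T) < 4 * N" using A by (subst (asm) mult_less_cancel_left_pos) auto
  have "Y\<^sup>2 < (2 * A * T + 2 * A + 3 * B)\<^sup>2"
    using lo Y L R(1) by (intro power_strict_mono) auto
  then have "(4 * A) * (3 * (N - B * T)) < (4 * A) * (A * T\<^sup>2 + 2 * A * T + 4 * A)"
    unfolding Y2 D_def by (simp add: power2_eq_square algebra_simps)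
  then have 2: "3 * (N - B * T) < A * T\<^sup>2 + 2 * A * T + 4 * A" using A by (subst (asm) mult_less_cancel_left_pos) auto
  have "real_of_int (a * t\<^sup>2 + 4 * (b * t)) < real_of_int (4 * n)"
    using 1 by (simp add: A_def B_def T_def N_def)
  moreover have "real_of_int (3 * (n - b * t)) < real_of_int (a * t\<^sup>2 + 2 * a * t + 4 * a)"
    using 2 by (simp add: A_def B_def T_def N_def)
  moreover have "0 < t" using T by (simp add: T_def)
  ultimately show ?thesis
    unfolding of_int_less_iff using t_def by blast
qed

text \<open>A common factor 2 with the even a is excluded, so b is odd and hence coprime to 2a, not
  just to a. The modulus 2a is what controls the parity of (n - b t)/a.\<close>

lemma exists_linear_cong:
  fixes a b c :: int
  assumes "coprime a b" and "even a"
  shows "\<exists>t j. b * t + 2 * a * j = c"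
proof -
  have "odd b" using assms by (metis coprime_common_divisor odd_one)
  then have "coprime b (2 * a)" using assms(1) by (simp add: coprime_commute)
  moreover obtain u v where "u * b + v * (2 * a) = gcd b (2 * a)" using bezout_int by blast
  ultimately have "c * (u * b + v * (2 * a)) = c" by simp
  then have "b * (c * u) + 2 * a * (c * v) = c" by (simp add: algebra_simps)
  then show ?thesis by blast
qed

lemma sum_four_quad_values:
  fixes a b :: int
  assumes "s = (int w)\<^sup>2 + (int x)\<^sup>2 + (int y)\<^sup>2 + (int z)\<^sup>2" and "t = int w + int x + int y + int z"
    and "n = a * s + b * t"
  shows "n = int w * (a * int w + b) + int x * (a * int x + b) + int y * (a * int y + b) + int z * (a * int z + b)"
  unfolding assms by (simp add: power2_eq_square algebra_simps)

lemma odd_representable: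
  fixes a b n :: int
  assumes "2 \<le> a" "- a < b" "even a" "coprime a b" "odd n"
    and n: "real_of_int n > 4 * real_of_int a * (7 * real_of_int a * (real_of_int a - 1) + 1)
          + 2 * (7 * real_of_int a - 2) * real_of_int b
          + 2 * (2 * real_of_int a * (2 * real_of_int a - 1) + real_of_int b)
            * sqrt (6 * (2 * real_of_int a * (real_of_int a - 1) + real_of_int b))"
  shows "\<exists>w x y z :: nat. n = int w * (a * int w + b) + int x * (a * int x + b)
              + int y * (a * int y + b) + int z * (a * int z + b)"
proof -
  define A B where "A = real_of_int a" and "B = real_of_int b"
  define S where "S = sqrt (6 * (2 * A * (A - 1) + B))"
  have AB: "2 \<le> A" "- A < B"
    using assms(1,2) unfolding A_def B_def by linarith+
  have "2 * A * 1 \<le> 2 * A * (A - 1)" using AB by (intro mult_left_mono) auto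
  with AB have "0 \<le> 2 * A * (A - 1) + B" by linarith
  then have Q: "0 \<le> 6 * (2 * A * (A - 1) + B)" by (intro mult_nonneg_nonneg) auto
  have S: "0 \<le> S" "S\<^sup>2 = 6 * (2 * A * (A - 1) + B)"
    unfolding S_def by (rule real_sqrt_ge_zero[OF Q], rule real_sqrt_pow2[OF Q])
  \<comment> \<open>The right side n - a, rather than n, makes s = (n - b t)/a odd for every t in
    the class of \<open>\<tau>\<close> modulo 2a; t itself is odd because n is odd and a is
    even.\<close>
  obtain \<tau> j where \<tau>: "b * \<tau> + 2 * a * j = n - a" using exists_linear_cong[OF assms(4,3)] by blast
  have "\<exists>k t. t = \<tau> + (2 * a) * k \<and> 0 < t \<and> a * t\<^sup>2 + 4 * (b * t) < 4 * n \<and> 3 * (n - b * t) < a * t\<^sup>2 + 2 * a * t + 4 * a"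
  \<comment> \<open>With M = 2A, 48AM(AM - 2A + B) is (4A)^2 times the radicand. The cross term
    24ALS of the square is 12A times the root term of the bound.\<close>
  proof (rule exists_admissible_sum[where R = "4 * A * S"], unfold A_def[symmetric] B_def[symmetric] of_int_mult of_int_numeral)
    show "0 \<le> 4 * A * S" using AB S by simp
    show "(4 * A * S)\<^sup>2 = 48 * A * (2 * A) * (A * (2 * A) - 2 * A + B)"
      unfolding power_mult_distrib S by (simp add: power2_eq_square algebra_simps)
    have "12 * A * (4 * A * (7 * A * (A - 1) + 1) + 2 * (7 * A - 2) * B + 2 * (2 * A * (2 * A - 1) + B) * S) < 12 * A * real_of_int n"
      using n AB unfolding A_def[symmetric] B_def[symmetric] S_def[symmetric] by (intro mult_strict_left_mono) auto
    moreover have "(3 * L + 4 * A * S)\<^sup>2 = 9 * L\<^sup>2 + 24 * A * L * S + 16 * A\<^sup>2 * S\<^sup>2" for L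
      by (simp add: power2_eq_square algebra_simps)
    ultimately show "(3 * (2 * A * (2 * A) - 2 * A + B) + 4 * A * S)\<^sup>2 < 12 * A * real_of_int n + (9 * B\<^sup>2 + 12 * A * B - 12 * A\<^sup>2)"
      unfolding S(2) by (simp add: power2_eq_square algebra_simps)
  qed (use assms in auto)
  then obtain k t where t: "t = \<tau> + (2 * a) * k" "0 < t" "a * t\<^sup>2 + 4 * (b * t) < 4 * n" "3 * (n - b * t) < a * t\<^sup>2 + 2 * a * t + 4 * a"
    by blast
  define s where "s = 2 * (j - b * k) + 1"
  have n_eq: "n = a * s + b * t" using \<tau> unfolding s_def t(1) by (simp add: algebra_simps)
  have "odd s" by (simp add: s_def)
  moreover have "odd t" using assms(3,5) n_eq by auto
  moreover have "t\<^sup>2 < 4 * s"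
  proof -
    have "a * t\<^sup>2 < a * (4 * s)" using t(3) unfolding n_eq by simp
    then show ?thesis using assms(1) by (subst (asm) mult_less_cancel_left_pos) auto
  qed
  moreover have "3 * s < t\<^sup>2 + 2 * t + 4"
  proof -
    have "a * (3 * s) < a * (t\<^sup>2 + 2 * t + 4)" using t(4) unfolding n_eq by (simp add: algebra_simps)
    then show ?thesis using assms(1) by (subst (asm) mult_less_cancel_left_pos) auto
  qed
  ultimately obtain w x y z :: nat where "s = (int w)\<^sup>2 + (int x)\<^sup>2 + (int y)\<^sup>2 + (int z)\<^sup>2" "t = int w + int x + int y + int z"
    using cauchy_lemma_odd[of s t] t(2) by auto
  from sum_four_quad_values[OF this n_eq] show ?thesis by blast
qed

lemma even_representable:
  fixes a b n :: int
  assumes "2 \<le> a" "- a < b" "even a" "coprime a b" "even n"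
    and n: "real_of_int n / 4 > 28 * real_of_int a ^ 3 - 14 * real_of_int a ^ 2 + real_of_int a
          + (7 * real_of_int a - 1) * real_of_int b
          + (2 * real_of_int a * (4 * real_of_int a - 1) + real_of_int b)
            * sqrt (3 * (2 * real_of_int a * (2 * real_of_int a - 1) + real_of_int b))"
  shows "\<exists>w x y z :: nat. n = int w * (a * int w + b) + int x * (a * int x + b)
              + int y * (a * int y + b) + int z * (a * int z + b)"
proof -
  define A B where "A = real_of_int a" and "B = real_of_int b"
  define S where "S = sqrt (3 * (2 * A * (2 * A - 1) + B))"
  have AB: "2 \<le> A" "- A < B"
    using assms(1,2) unfolding A_def B_def by linarith+
  have "2 * A * 1 \<le> 2 * A * (2 * A - 1)" using AB by (intro mult_left_mono) auto
  with AB have "0 \<le> 2 * A * (2 * A - 1) + B" by linarith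
  then have Q: "0 \<le> 3 * (2 * A * (2 * A - 1) + B)" by (intro mult_nonneg_nonneg) auto
  have S: "0 \<le> S" "S\<^sup>2 = 3 * (2 * A * (2 * A - 1) + B)"
    unfolding S_def by (rule real_sqrt_ge_zero[OF Q], rule real_sqrt_pow2[OF Q])
  obtain n' where n': "n = 2 * n'" using assms(5) ..
  \<comment> \<open>Solving the congruence for n/2 gives n/2 - b u = a h with h odd; t = 2u then
    runs through a class modulo 4a.\<close>
  obtain \<tau> j where \<tau>: "b * \<tau> + 2 * a * j = n' - a" using exists_linear_cong[OF assms(4,3)] by blast
  have "\<exists>k t. t = 2 * \<tau> + (4 * a) * k \<and> 0 < t \<and> a * t\<^sup>2 + 4 * (b * t) < 4 * n \<and> 3 * (n - b * t) < a * t\<^sup>2 + 2 * a * t + 4 * a"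
  \<comment> \<open>With M = 4A, 48AM(AM - 2A + B) is (8A)^2 times the radicand. The bound is for
    n/4, hence the multiplier 48A in place of 12A.\<close>
  proof (rule exists_admissible_sum[where R = "8 * A * S"], unfold A_def[symmetric] B_def[symmetric] of_int_mult of_int_numeral)
    show "0 \<le> 8 * A * S" using AB S by simp
    show "(8 * A * S)\<^sup>2 = 48 * A * (4 * A) * (A * (4 * A) - 2 * A + B)"
      unfolding power_mult_distrib S by (simp add: power2_eq_square algebra_simps)
    have "48 * A * (28 * A ^ 3 - 14 * A ^ 2 + A + (7 * A - 1) * B + (2 * A * (4 * A - 1) + B) * S) < 48 * A * (real_of_int n / 4)"
      using n AB unfolding A_def[symmetric] B_def[symmetric] S_def[symmetric] by (intro mult_strict_left_mono) auto
    moreover have "(3 * L + 8 * A * S)\<^sup>2 = 9 * L\<^sup>2 + 48 * A * L * S + 64 * A\<^sup>2 * S\<^sup>2" for L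
      by (simp add: power2_eq_square algebra_simps)
    ultimately show "(3 * (2 * A * (4 * A) - 2 * A + B) + 8 * A * S)\<^sup>2 < 12 * A * real_of_int n + (9 * B\<^sup>2 + 12 * A * B - 12 * A\<^sup>2)"
      unfolding S(2) by (simp add: power2_eq_square power3_eq_cube algebra_simps)
  qed (use assms in auto)
  then obtain k t where t: "t = 2 * \<tau> + (4 * a) * k" "0 < t" "a * t\<^sup>2 + 4 * (b * t) < 4 * n" "3 * (n - b * t) < a * t\<^sup>2 + 2 * a * t + 4 * a"
    by blast
  define u where "u = \<tau> + 2 * a * k"
  have tu: "t = 2 * u" unfolding t(1) u_def by simp
  define h where "h = 2 * (j - b * k) + 1"
  have n_eq: "n = a * (2 * h) + b * (2 * u)" using \<tau> n' unfolding h_def u_def by (simp add: algebra_simps)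
  have "odd h" by (simp add: h_def)
  moreover have "u\<^sup>2 < 2 * h"
  proof -
    have "a * (4 * u\<^sup>2) < a * (4 * (2 * h))" using t(3) unfolding n_eq tu by (simp add: power_mult_distrib)
    then have "4 * u\<^sup>2 < 4 * (2 * h)" using assms(1) by (subst (asm) mult_less_cancel_left_pos) auto
    then show ?thesis by simp
  qed
  moreover have "3 * (2 * h) < (2 * u)\<^sup>2 + 2 * (2 * u) + 4"
  proof -
    have "a * (3 * (2 * h)) < a * ((2 * u)\<^sup>2 + 2 * (2 * u) + 4)" using t(4) unfolding n_eq tu by (simp add: algebra_simps)
    then show ?thesis using assms(1) by (subst (asm) mult_less_cancel_left_pos) auto
  qed
  ultimately obtain w x y z :: nat where "2 * h = (int w)\<^sup>2 + (int x)\<^sup>2 + (int y)\<^sup>2 + (int z)\<^sup>2" "2 * u = int w + int x + int y + int z"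
    using cauchy_lemma_even[of h u] t(2) tu by auto
  from sum_four_quad_values[OF this n_eq] show ?thesis by blast
qed

theorem theorem2:
  fixes a b :: int
  assumes "0 < a" and "- a < b" and "even a" and "gcd a b = 1"
  shows "asymptotic_base 4 (quad_values a b) \<and>
    (\<forall>n::int.
      (odd n \<and>
        real_of_int n >
          4 * real_of_int a * (7 * real_of_int a * (real_of_int a - 1) + 1)
          + 2 * (7 * real_of_int a - 2) * real_of_int b
          + 2 * (2 * real_of_int a * (2 * real_of_int a - 1) + real_of_int b)
            * sqrt (6 * (2 * real_of_int a * (real_of_int a - 1) + real_of_int b))
       \<or> even n \<and>
        real_of_int n / 4 >
          28 * real_of_int a ^ 3 - 14 * real_of_int a ^ 2 + real_of_int a
          + (7 * real_of_int a - 1) * real_of_int b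
          + (2 * real_of_int a * (4 * real_of_int a - 1) + real_of_int b)
            * sqrt (3 * (2 * real_of_int a * (2 * real_of_int a - 1) + real_of_int b)))
      \<longrightarrow> (\<exists>w x y z :: nat.
            n = int w * (a * int w + b) + int x * (a * int x + b)
              + int y * (a * int y + b) + int z * (a * int z + b)))"
    (is "_ \<and> (\<forall>n. odd n \<and> real_of_int n > ?o \<or> even n \<and> real_of_int n / 4 > ?e \<longrightarrow> ?rep n)")
proof
  have a: "2 \<le> a" using assms(1,3) by presburger
  have cop: "coprime a b" using assms(4) by (simp add: coprime_iff_gcd_eq_1)
  show rep: "\<forall>n. odd n \<and> real_of_int n > ?o \<or> even n \<and> real_of_int n / 4 > ?e \<longrightarrow> ?rep n"
    using odd_representable[OF a assms(2,3) cop] even_representable[OF a assms(2,3) cop] by blast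
  define N where "N = nat \<lceil>max ?o (4 * ?e)\<rceil>"
  have "m \<in> kfold_sumset 4 (quad_values a b)" if m: "N < m" for m
  proof -
    have "max ?o (4 * ?e) < real_of_int (int m)"
      using m unfolding N_def by linarith
    moreover have "x < m \<and> y < m / 4" if "max x (4 * y) < m" for x y m :: real
      using that by auto
    ultimately have "?o < real_of_int (int m) \<and> ?e < real_of_int (int m) / 4" by blast
    then obtain w x y z :: nat where e: "int m = int w * (a * int w + b) + int x * (a * int x + b)
              + int y * (a * int y + b) + int z * (a * int z + b)"
      using rep by (cases "even (int m)") blast+
    define f where "f v = nat (int v * (a * int v + b))" for v
    have f: "int (f v) = int v * (a * int v + b)" for v
      unfolding f_def using quad_value_nonneg[OF assms(1,2)] by simp
    have "int m = int (sum_list [f w, f x, f y, f z])" unfolding e by (simp add: f)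
    then have "m = sum_list [f w, f x, f y, f z]" by (simp only: of_nat_eq_iff)
    moreover have "set [f w, f x, f y, f z] \<subseteq> quad_values a b"
      using f by (auto simp: quad_values_def)
    ultimately show ?thesis
      unfolding kfold_sumset_def by (intro CollectI exI[of _ "[f w, f x, f y, f z]"]) simp
  qed
  then have "UNIV - kfold_sumset 4 (quad_values a b) \<subseteq> {..N}"
    by (auto simp: not_less[symmetric])
  then show "asymptotic_base 4 (quad_values a b)"
    unfolding asymptotic_base_def by (rule finite_subset) simp
qed

end
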